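(* Let $f:\mathbb{C}\to\mathbb{C}$ be an entire function of finite order. Assume that $f$ admits $n$ distinct $\varepsilon$-approximate asymptotic values $a_1,\dots,a_n$, with $\varepsilon<\min_{i\neq j}\frac{|a_i-a_j|}{5}$. Then the order of $f$ is at least $n/2$.
   Context: The order of $f$ is $\rho(f)=\limsup_{r\to\infty}\frac{\log^+\log^+M(r,f)}{\log r}$, where $M(r,f)=\max_{|z|=r}|f(z)|$. A point $a\in\mathbb{C}$ is an $\varepsilon$-approximate asymptotic value of $f$ if there is a continuous path $\gamma:[0,\infty)\to\mathbb{C}$ with $\gamma(t)\to\infty$ such that $\limsup_{t\to\infty}|f(\gamma(t))-a|<\varepsilon$. *)

theory Defs
  imports "HOL-Complex_Analysis.Complex_Analysis" "HOL-Library.Liminf_Limsup"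
begin

definition logplus :: "real \<Rightarrow> real" where
  "logplus x = max 0 (ln x)"

definition max_modulus :: "(complex \<Rightarrow> complex) \<Rightarrow> real \<Rightarrow> real" where
  "max_modulus f r = Sup ((\<lambda>z. cmod (f z)) ` sphere 0 r)"

definition entire_order :: "(complex \<Rightarrow> complex) \<Rightarrow> ereal" where
  "entire_order f =
     Limsup at_top (\<lambda>r::real. ereal (logplus (logplus (max_modulus f r)) / ln r))"

definition approx_asymptotic_value ::
    "real \<Rightarrow> (complex \<Rightarrow> complex) \<Rightarrow> complex \<Rightarrow> bool" where
  "approx_asymptotic_value eps f a \<longleftrightarrow>
     (\<exists>\<gamma> :: real \<Rightarrow> complex.
        continuous_on {0..} \<gamma> \<and>
        filterlim \<gamma> at_infinity at_top \<and>
        Limsup at_top (\<lambda>t. ereal (cmod (f (\<gamma> t) - a))) < ereal eps)"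

end

theory Submission
  imports Defs
begin

text \<open>
  Carleman's proof of the Denjoy--Carleman--Ahlfors theorem, in logarithmic coordinates \<open>z = s + \<i> t\<close>.
  The asymptotic paths lift through \<open>exp\<close> to disjoint curves that run to the right. They cut the plane
  into \<open>n\<close> regions modulo \<open>2 \<pi> \<i>\<close>. In the region between paths with values \<open>a\<close> and \<open>b\<close> consider
  \<open>h = (f \<circ> exp - a) (f \<circ> exp - b) / (6 \<bar>a - b\<bar>\<^sup>2 / 25)\<close>. Since \<open>\<epsilon> < \<bar>a - b\<bar> / 5\<close>, we have \<open>\<bar>h\<bar> < 1\<close> on the
  two boundary curves, whereas every vertical section of the region contains a point with equal distance of
  \<open>f \<circ> exp\<close> to \<open>a\<close> and \<open>b\<close>, where \<open>\<bar>h\<bar> \<ge> 25 / 24\<close>. Let \<open>v\<close> be a smooth subharmonic version of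
  \<open>log\<^sup>+ \<bar>h\<bar>\<close>, extended by zero outside the region, and let \<open>B s = \<integral> v v\<^sub>s dt\<close>. Subharmonicity, integration by
  parts and Wirtinger's inequality give \<open>B' \<ge> \<integral> v\<^sub>s\<^sup>2 + v\<^sub>t\<^sup>2 dt \<ge> (2 \<pi> / l) B\<close>, where \<open>l\<close> is the length of the
  section, and the oscillation of \<open>v\<close> on a section bounds \<open>B'\<close> from below by a positive constant, so
  that \<open>B\<close> becomes positive. The \<open>n\<close> lengths add up to at most \<open>2 \<pi>\<close>; hence the product of the \<open>n\<close> functions \<open>B\<close>
  grows at least like \<open>exp (n\<^sup>2 s)\<close>, while order less than \<open>\<rho>\<close> bounds it by a multiple of \<open>exp (2 n \<rho> s)\<close>.
\<close>

section \<open>Wirtinger's inequality and energy on a strip\<close>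

text \<open>The difference quotient of the product is dominated by \<open>C\<close> times that of
  \<open>g\<close>, so \<open>y\<close> needs no regularity at all. This covers the cotangent weight
  of Wirtinger's inequality at points outside \<open>T\<close> and the gluing of
  \<open>softlog\<close> to zero at 1.\<close>

lemma has_real_derivative_mult_bounded:
  fixes g y :: "real \<Rightarrow> real"
  assumes "(g has_real_derivative 0) (at x)" "g x = 0" "\<And>t. \<bar>y t\<bar> \<le> C"
  shows "((\<lambda>t. g t * y t) has_real_derivative 0) (at x)"
proof -
  have "((\<lambda>t. (g t - g x) / (t - x)) \<longlongrightarrow> 0) (at x)"
    using assms(1) by (simp add: has_field_derivative_iff)
  then have "((\<lambda>t. \<bar>g t / (t - x)\<bar> * C) \<longlongrightarrow> 0) (at x)"
    using assms(2) by (intro tendsto_mult_left_zero tendsto_rabs_zero) simp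
  then have "((\<lambda>t. (g t * y t - g x * y x) / (t - x)) \<longlongrightarrow> 0) (at x)"
  proof (rule Lim_null_comparison[rotated])
    show "\<forall>\<^sub>F t in at x. norm ((g t * y t - g x * y x) / (t - x)) \<le> \<bar>g t / (t - x)\<bar> * C"
    proof (intro always_eventually allI)
      fix t
      have "norm ((g t * y t - g x * y x) / (t - x)) = \<bar>g t / (t - x)\<bar> * \<bar>y t\<bar>"
        by (simp add: assms(2) abs_mult)
      also have "\<dots> \<le> \<bar>g t / (t - x)\<bar> * C"
        by (intro mult_left_mono assms(3)) auto
      finally show "norm ((g t * y t - g x * y x) / (t - x)) \<le> \<bar>g t / (t - x)\<bar> * C" .
    qed
  qed
  then show ?thesis by (simp add: has_field_derivative_iff)
qed

text \<open>On a ball inside \<open>T\<close> moving the endpoint adds exactly the length moved, so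
  the function is affine of slope 1 there.\<close>

lemma measure_initial_segment_derivative:
  fixes T :: "real set"
  assumes T: "open T" "bounded T" and x: "x \<in> T"
  shows "((\<lambda>t. measure lebesgue (T \<inter> {..t})) has_real_derivative 1) (at x)"
proof -
  define X where "X = (\<lambda>t. measure lebesgue (T \<inter> {..t}))"
  obtain e where e: "e > 0" "ball x e \<subseteq> T"
    using T x open_contains_ball by blast
  have lm: "T \<inter> {..t} \<in> lmeasurable" for t
    using T by (intro bounded_set_imp_lmeasurable) (auto intro: bounded_subset)
  have step: "X w = X u + (w - u)" if "u \<le> w" "{u<..w} \<subseteq> T" for u w
  proof -
    have eq: "T \<inter> {..w} = (T \<inter> {..u}) \<union> {u<..w}" using that by auto
    have "measure lebesgue ((T \<inter> {..u}) \<union> {u<..w}) =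
        measure lebesgue (T \<inter> {..u}) + measure lebesgue {u<..w}"
    proof -
      have "{u<..w} \<in> lmeasurable" by (intro bounded_set_imp_lmeasurable) auto
      moreover have "T \<inter> {..u} \<inter> {u<..w} = {}" by auto
      ultimately show ?thesis using measure_Un3[OF lm[of u], of "{u<..w}"] by simp
    qed
    then show ?thesis using that(1) eq by (simp add: X_def)
  qed
  have loc: "X t = X x + (t - x)" if "t \<in> ball x e" for t
  proof (cases "x \<le> t")
    case True
    have "{x<..t} \<subseteq> ball x e" using that by (auto simp: dist_real_def)
    then show ?thesis using step[of x t] True e by auto
  next
    case False
    have "{t<..x} \<subseteq> ball x e" using that by (auto simp: dist_real_def)
    then show ?thesis using step[of t x] False e by auto
  qed
  have "(X has_real_derivative 1) (at x)"
  proof (rule has_field_derivative_transform_within_open)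
    show "((\<lambda>t. X x + (t - x)) has_real_derivative 1) (at x)"
      by (auto intro!: derivative_eq_intros)
    show "open (ball x e)" "x \<in> ball x e" using e by auto
  qed (use loc in auto)
  then show ?thesis by (simp add: X_def)
qed

text \<open>The primitive is \<open>v\<^sup>2 \<lambda> cot (\<lambda> X)\<close>, where \<open>X t\<close> is the (shifted) measure of \<open>T\<close> to the left
  of \<open>t\<close>: measuring along \<open>T\<close> instead of along the line makes it unnecessary to split \<open>T\<close> into its components.\<close>

lemma wirtinger_open_aux:
  fixes v v' :: "real \<Rightarrow> real" and T :: "real set"
  assumes T: "open T" "T \<subseteq> {a..b}" and ab: "a \<le> b"
    and der: "\<And>x. (v has_real_derivative v' x) (at x)"
    and cont: "continuous_on UNIV v'"
    and zero: "\<And>x. x \<notin> T \<Longrightarrow> v x = 0"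
    and l: "l > measure lebesgue T"
  shows "pi\<^sup>2 * integral {a..b} (\<lambda>x. (v x)\<^sup>2) \<le> l\<^sup>2 * integral {a..b} (\<lambda>x. (v' x)\<^sup>2)"
proof -
  define m where "m = measure lebesgue T"
  \<comment> \<open>The excess of \<open>l\<close> over the measure is split evenly between both
    ends. Then \<open>c * (X t + d)\<close> stays in a compact subinterval of the open interval from
    0 to pi, and the cotangent remains bounded.\<close>
  define d where "d = (l - m) / 2"
  define c where "c = pi / l"
  define X where "X = (\<lambda>t. measure lebesgue (T \<inter> {..t}))"
  define y where "y = (\<lambda>t. c * cot (c * (X t + d)))"
  have m0: "m \<ge> 0" by (simp add: m_def)
  have l0: "l > 0" using l m0 m_def by linarith
  have d0: "d > 0" using l by (simp add: d_def m_def)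
  have c0: "c > 0" using l0 by (simp add: c_def)
  have bT: "bounded T" using T(2) bounded_subset[of "{a..b}" T] by auto
  have lmT: "T \<in> lmeasurable" using T bT by (intro bounded_set_imp_lmeasurable) auto
  have Xr: "0 \<le> X t" "X t \<le> m" for t
    unfolding X_def m_def using T by (simp, intro measure_mono_fmeasurable[OF _ _ lmT] sets.Int) auto
  have rng: "c * (X t + d) \<in> {c * d .. c * (m + d)}" for t
    using Xr[of t] c0 by (auto intro!: mult_left_mono)
  have pos: "sin u > 0" if "u \<in> {c * d .. c * (m + d)}" for u
  proof (rule sin_gt_zero)
    have "0 < c * d" using c0 d0 by simp
    then show "0 < u" using that by auto
    have "c * (m + d) < c * l" using c0 d0 by (intro mult_strict_left_mono) (auto simp: d_def field_simps)
    also have "c * l = pi" using l0 by (simp add: c_def)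
    finally show "u < pi" using that by auto
  qed
  have "bounded ((\<lambda>u. c * cot u) ` {c * d .. c * (m + d)})"
    using pos by (intro compact_imp_bounded compact_continuous_image continuous_intros) force+
  then obtain C where C: "\<And>u. u \<in> {c * d .. c * (m + d)} \<Longrightarrow> \<bar>c * cot u\<bar> \<le> C"
    unfolding bounded_iff by (metis imageI real_norm_def)
  have yC: "\<bar>y t\<bar> \<le> C" for t using C[OF rng] by (simp add: y_def)
  define F where "F = (\<lambda>t. (v t)\<^sup>2 * y t)"
  \<comment> \<open>Outside \<open>T\<close> the weight \<open>y\<close> may fail to be
    differentiable, but the double zero of the square of \<open>v\<close> forces the derivative of
    \<open>F\<close> to be 0 there.\<close>
  define F' where "F' = (\<lambda>t. if t \<in> T then (2 * v t * v' t * y t - c\<^sup>2 * (v t)\<^sup>2 - (v t)\<^sup>2 * (y t)\<^sup>2) else 0)"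
  have derF: "(F has_real_derivative F' t) (at t)" for t
  proof (cases "t \<in> T")
    case True
    have X': "(X has_real_derivative 1) (at t)"
      unfolding X_def by (rule measure_initial_segment_derivative[OF T(1) bT True])
    have s0: "sin (c * (X t + d)) \<noteq> 0" using pos[OF rng[of t]] by simp
    have y': "(y has_real_derivative - c\<^sup>2 - (y t)\<^sup>2) (at t)"
    proof -
      have "(y has_real_derivative c * (- inverse ((sin (c * (X t + d)))\<^sup>2) * (c * (1 + 0)))) (at t)"
        unfolding y_def
        by (intro DERIV_cmult DERIV_chain2[where f = cot and g = "\<lambda>t. c * (X t + d)", OF DERIV_cot[OF s0]]
            DERIV_add X' DERIV_const)
      moreover have "inverse ((sin u)\<^sup>2) = 1 + (cot u)\<^sup>2" if "sin u \<noteq> 0" for u :: real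
        using that sin_cos_squared_add[of u] by (simp add: cot_def field_simps)
      ultimately show ?thesis
        using s0 by (auto simp: y_def power2_eq_square algebra_simps)
    qed
    have "(F has_real_derivative 2 * v t * v' t * y t + (v t)\<^sup>2 * (- c\<^sup>2 - (y t)\<^sup>2)) (at t)"
      unfolding F_def by (auto intro!: derivative_eq_intros der y' simp: algebra_simps)
    then show ?thesis using True by (simp add: F'_def algebra_simps)
  next
    case False
    have "((\<lambda>t. (v t)\<^sup>2) has_real_derivative 0) (at t)"
      using zero[OF False] by (auto intro!: derivative_eq_intros der)
    then show ?thesis
      unfolding F_def F'_def using has_real_derivative_mult_bounded[OF _ _ yC] zero[OF False] False by simp
  qed
  have cv: "continuous_on S v" for S
    using der by (meson DERIV_atLeastAtMost_imp_continuous_on DERIV_isCont continuous_at_imp_continuous_on)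
  have iv: "(\<lambda>x. (v x)\<^sup>2) integrable_on {a..b}" "(\<lambda>x. (v' x)\<^sup>2) integrable_on {a..b}"
    by (intro integrable_continuous_interval continuous_intros cv continuous_on_subset[OF cont]; simp)+
  have nT: "a \<notin> T" "b \<notin> T"
  proof -
    have "T \<subseteq> {a<..<b}" using T interior_maximal[of T "{a..b}"] by simp
    then show "a \<notin> T" "b \<notin> T" by auto
  qed
  have "(F' has_integral (F b - F a)) {a..b}"
    using derF by (intro fundamental_theorem_of_calculus ab)
      (auto simp: has_real_derivative_iff_has_vector_derivative intro: has_vector_derivative_at_within)
  then have F0: "(F' has_integral 0) {a..b}" using zero nT by (simp add: F_def)
  have "0 \<le> integral {a..b} (\<lambda>x. (v' x)\<^sup>2 - c\<^sup>2 * (v x)\<^sup>2)"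
  proof (rule has_integral_le[OF F0])
    show "((\<lambda>x. (v' x)\<^sup>2 - c\<^sup>2 * (v x)\<^sup>2) has_integral integral {a..b} (\<lambda>x. (v' x)\<^sup>2 - c\<^sup>2 * (v x)\<^sup>2)) {a..b}"
      using iv by (intro integrable_integral integrable_diff integrable_on_mult_right) auto
    fix x
    \<comment> \<open>The Riccati equation \<open>y' = - c\<^sup>2 - y\<^sup>2\<close> makes the
      difference of the two sides on \<open>T\<close> exactly this square.\<close>
    have "0 \<le> (v' x - v x * y x)\<^sup>2" by simp
    then show "F' x \<le> (v' x)\<^sup>2 - c\<^sup>2 * (v x)\<^sup>2"
      using zero[of x] by (auto simp: F'_def power2_eq_square algebra_simps)
  qed
  also have "\<dots> = integral {a..b} (\<lambda>x. (v' x)\<^sup>2) - c\<^sup>2 * integral {a..b} (\<lambda>x. (v x)\<^sup>2)"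
    using iv by (subst integral_diff) (auto intro: integrable_on_mult_right)
  finally have "c\<^sup>2 * integral {a..b} (\<lambda>x. (v x)\<^sup>2) \<le> integral {a..b} (\<lambda>x. (v' x)\<^sup>2)" by simp
  then have "l\<^sup>2 * (c\<^sup>2 * integral {a..b} (\<lambda>x. (v x)\<^sup>2)) \<le> l\<^sup>2 * integral {a..b} (\<lambda>x. (v' x)\<^sup>2)"
    by (intro mult_left_mono) auto
  then show ?thesis using l0 by (simp add: c_def field_simps)
qed

text \<open>The cotangent argument needs \<open>l\<close> strictly above the measure; the sharp
  constant follows by letting \<open>l\<close> decrease to it.\<close>

lemma wirtinger_open:
  fixes v v' :: "real \<Rightarrow> real" and T :: "real set"
  assumes T: "open T" "T \<subseteq> {a..b}" and ab: "a \<le> b"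
    and der: "\<And>x. (v has_real_derivative v' x) (at x)"
    and cont: "continuous_on UNIV v'"
    and zero: "\<And>x. x \<notin> T \<Longrightarrow> v x = 0"
  shows "pi\<^sup>2 * integral {a..b} (\<lambda>x. (v x)\<^sup>2) \<le> (measure lebesgue T)\<^sup>2 * integral {a..b} (\<lambda>x. (v' x)\<^sup>2)"
proof -
  let ?m = "measure lebesgue T"
  have "((\<lambda>l. l\<^sup>2 * integral {a..b} (\<lambda>x. (v' x)\<^sup>2)) \<longlongrightarrow> ?m\<^sup>2 * integral {a..b} (\<lambda>x. (v' x)\<^sup>2)) (at_right ?m)"
    by (intro tendsto_intros)
  moreover have "\<forall>\<^sub>F l in at_right ?m. pi\<^sup>2 * integral {a..b} (\<lambda>x. (v x)\<^sup>2) \<le> l\<^sup>2 * integral {a..b} (\<lambda>x. (v' x)\<^sup>2)"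
    by (rule eventually_mono[OF eventually_at_right_less])
      (rule wirtinger_open_aux[OF T ab der cont zero])
  ultimately show ?thesis by (rule tendsto_lowerbound) simp
qed

lemma integral_le_support_measure:
  fixes g :: "real \<Rightarrow> real"
  assumes T: "open T" "T \<subseteq> {a..b}" and g: "continuous_on {a..b} g"
    and C: "\<And>t. t \<in> T \<Longrightarrow> g t \<le> C" and zero: "\<And>t. t \<notin> T \<Longrightarrow> g t = 0"
  shows "integral {a..b} g \<le> C * measure lebesgue T"
proof -
  have lm: "T \<inter> {a..b} \<in> lmeasurable"
    using T by (intro bounded_set_imp_lmeasurable) auto
  have "integral {a..b} g \<le> integral {a..b} (\<lambda>t. C * indicator T t)"
  proof (rule integral_le)
    show "g integrable_on {a..b}" using g by (rule integrable_continuous_interval)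
    show "(\<lambda>t. C * indicator T t) integrable_on {a..b}"
      using lm by (intro integrable_on_mult_right) (simp add: integrable_on_indicator)
    show "g t \<le> C * indicator T t" if "t \<in> {a..b}" for t
      using C[of t] zero[of t] by (auto simp: indicator_def)
  qed
  also have "\<dots> = C * measure lebesgue (T \<inter> {a..b})"
    using lm by (simp add: integral_indicator)
  also have "T \<inter> {a..b} = T" using T by auto
  finally show ?thesis .
qed

section \<open>Energy estimates for a subharmonic function on a strip\<close>

text \<open>\<open>T s\<close> is the vertical section at abscissa \<open>s\<close> of the region
  that carries \<open>v\<close>. All sections lie in one interval from \<open>a\<close> to
  \<open>b\<close>, so the integrals have fixed limits and can be differentiated in \<open>s\<close>
  under the integral sign, while \<open>len s\<close> still measures the section itself.\<close>

locale subharmonic_strip =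
  fixes v vs vss vt vtt :: "real \<Rightarrow> real \<Rightarrow> real" and \<alpha> \<beta> a b :: real and T :: "real \<Rightarrow> real set"
  assumes ab: "a \<le> b"
    and ds: "\<And>s t. \<alpha> < s \<Longrightarrow> s < \<beta> \<Longrightarrow> ((\<lambda>s. v s t) has_real_derivative vs s t) (at s)"
    and dss: "\<And>s t. \<alpha> < s \<Longrightarrow> s < \<beta> \<Longrightarrow> ((\<lambda>s. vs s t) has_real_derivative vss s t) (at s)"
    and dt: "\<And>s t. \<alpha> < s \<Longrightarrow> s < \<beta> \<Longrightarrow> ((\<lambda>t. v s t) has_real_derivative vt s t) (at t)"
    and dtt: "\<And>s t. \<alpha> < s \<Longrightarrow> s < \<beta> \<Longrightarrow> ((\<lambda>t. vt s t) has_real_derivative vtt s t) (at t)"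
    and cont: "continuous_on ({\<alpha><..<\<beta>} \<times> UNIV) (\<lambda>(s,t). v s t)"
      "continuous_on ({\<alpha><..<\<beta>} \<times> UNIV) (\<lambda>(s,t). vs s t)"
      "continuous_on ({\<alpha><..<\<beta>} \<times> UNIV) (\<lambda>(s,t). vss s t)"
      "continuous_on ({\<alpha><..<\<beta>} \<times> UNIV) (\<lambda>(s,t). vt s t)"
      "continuous_on ({\<alpha><..<\<beta>} \<times> UNIV) (\<lambda>(s,t). vtt s t)"
    and nonneg: "\<And>s t. \<alpha> < s \<Longrightarrow> s < \<beta> \<Longrightarrow> v s t \<ge> 0"
    and laplacian: "\<And>s t. \<alpha> < s \<Longrightarrow> s < \<beta> \<Longrightarrow> vss s t + vtt s t \<ge> 0"
    and T: "\<And>s. \<alpha> < s \<Longrightarrow> s < \<beta> \<Longrightarrow> open (T s)" "\<And>s. \<alpha> < s \<Longrightarrow> s < \<beta> \<Longrightarrow> T s \<subseteq> {a..b}"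
    and zero: "\<And>s t. \<alpha> < s \<Longrightarrow> s < \<beta> \<Longrightarrow> t \<notin> T s \<Longrightarrow> v s t = 0"
begin

text \<open>\<open>flux\<close> is the quantity B of the overview. It carries the differential
  inequalities, whereas its primitive, half of \<open>sq_mean\<close>, is the quantity that the
  growth of the function bounds from above.\<close>

definition sq_mean :: "real \<Rightarrow> real" where "sq_mean s = integral {a..b} (\<lambda>t. (v s t)\<^sup>2)"
definition flux :: "real \<Rightarrow> real" where "flux s = integral {a..b} (\<lambda>t. v s t * vs s t)"
definition flux' :: "real \<Rightarrow> real" where "flux' s = integral {a..b} (\<lambda>t. (vs s t)\<^sup>2 + v s t * vss s t)"

abbreviation len :: "real \<Rightarrow> real" where "len s \<equiv> measure lebesgue (T s)"

lemma cont_fst: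
  assumes "\<alpha> < s" "s < \<beta>"
  shows "continuous_on S (v s)" "continuous_on S (vs s)" "continuous_on S (vss s)"
    "continuous_on S (vt s)" "continuous_on S (vtt s)"
proof -
  have *: "continuous_on S (\<lambda>t. w s t)" if "continuous_on ({\<alpha><..<\<beta>} \<times> UNIV) (\<lambda>(s,t). w s t)"
    for w :: "real \<Rightarrow> real \<Rightarrow> real"
  proof -
    have "continuous_on S (\<lambda>t. (\<lambda>(s,t). w s t) (s, t))"
      by (rule continuous_on_compose2[OF that]) (use assms in \<open>auto intro!: continuous_intros\<close>)
    then show ?thesis by simp
  qed
  show "continuous_on S (v s)" "continuous_on S (vs s)" "continuous_on S (vss s)"
    "continuous_on S (vt s)" "continuous_on S (vtt s)"
    using cont[THEN *] by auto
qed

lemma cont_pair: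
  "continuous_on ({\<alpha><..<\<beta>} \<times> cbox a b) (\<lambda>p. v (fst p) (snd p))"
  "continuous_on ({\<alpha><..<\<beta>} \<times> cbox a b) (\<lambda>p. vs (fst p) (snd p))"
  "continuous_on ({\<alpha><..<\<beta>} \<times> cbox a b) (\<lambda>p. vss (fst p) (snd p))"
  using cont(1-3) by (auto simp: case_prod_unfold intro: continuous_on_subset)

lemma sq_mean_deriv:
  assumes "\<alpha> < s" "s < \<beta>"
  shows "(sq_mean has_real_derivative 2 * flux s) (at s)"
proof -
  have "((\<lambda>s. integral (cbox a b) (\<lambda>t. (v s t)\<^sup>2)) has_real_derivative
      integral (cbox a b) (\<lambda>t. 2 * (v s t * vs s t))) (at s within {\<alpha><..<\<beta>})"
  proof (rule leibniz_rule_field_derivative[where fx = "\<lambda>s t. 2 * (v s t * vs s t)"])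
    show "((\<lambda>x. (v x t)\<^sup>2) has_real_derivative 2 * (v x t * vs x t)) (at x within {\<alpha><..<\<beta>})"
      if "x \<in> {\<alpha><..<\<beta>}" for x t
    proof -
      have d: "((\<lambda>x. v x t) has_real_derivative vs x t) (at x within {\<alpha><..<\<beta>})"
        using that by (intro has_field_derivative_at_within[OF ds]) auto
      show ?thesis using DERIV_power[OF d, of 2] by (simp add: mult_ac)
    qed
    show "(\<lambda>t. (v x t)\<^sup>2) integrable_on cbox a b" if "x \<in> {\<alpha><..<\<beta>}" for x
      using that by (intro integrable_continuous continuous_intros cont_fst) auto
    show "continuous_on ({\<alpha><..<\<beta>} \<times> cbox a b) (\<lambda>(x, t). 2 * (v x t * vs x t))"
      unfolding case_prod_unfold by (intro continuous_intros cont_pair)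
  qed (use assms in auto)
  then show ?thesis
    using assms by (simp add: sq_mean_def[abs_def] flux_def at_within_open[of s "{\<alpha><..<\<beta>}"])
qed

lemma flux_deriv:
  assumes "\<alpha> < s" "s < \<beta>"
  shows "(flux has_real_derivative flux' s) (at s)"
proof -
  have "((\<lambda>s. integral (cbox a b) (\<lambda>t. v s t * vs s t)) has_real_derivative
      integral (cbox a b) (\<lambda>t. (vs s t)\<^sup>2 + v s t * vss s t)) (at s within {\<alpha><..<\<beta>})"
  proof (rule leibniz_rule_field_derivative[where fx = "\<lambda>s t. (vs s t)\<^sup>2 + v s t * vss s t"])
    show "((\<lambda>x. v x t * vs x t) has_real_derivative (vs x t)\<^sup>2 + v x t * vss x t) (at x within {\<alpha><..<\<beta>})"
      if "x \<in> {\<alpha><..<\<beta>}" for x t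
    proof -
      have d: "((\<lambda>x. v x t) has_real_derivative vs x t) (at x within {\<alpha><..<\<beta>})"
        "((\<lambda>x. vs x t) has_real_derivative vss x t) (at x within {\<alpha><..<\<beta>})"
        using that by (intro has_field_derivative_at_within[OF ds] has_field_derivative_at_within[OF dss]; simp)+
      show ?thesis using DERIV_mult[OF d] by (simp add: power2_eq_square algebra_simps)
    qed
    show "(\<lambda>t. v x t * vs x t) integrable_on cbox a b" if "x \<in> {\<alpha><..<\<beta>}" for x
      using that by (intro integrable_continuous continuous_intros cont_fst) auto
    show "continuous_on ({\<alpha><..<\<beta>} \<times> cbox a b) (\<lambda>(x, t). (vs x t)\<^sup>2 + v x t * vss x t)"
      unfolding case_prod_unfold by (intro continuous_intros cont_pair)
  qed (use assms in auto)
  then show ?thesis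
    using assms by (simp add: flux_def[abs_def] flux'_def at_within_open[of s "{\<alpha><..<\<beta>}"])
qed

text \<open>Multiply the Laplacian inequality by \<open>v\<close>, which is nonnegative, and
  integrate \<open>v * vtt\<close> by parts. No boundary term survives: an open set inside a closed
  interval misses its endpoints, so \<open>v\<close> vanishes at \<open>a\<close> and
  \<open>b\<close>.\<close>

lemma flux'_ge_energy:
  assumes s: "\<alpha> < s" "s < \<beta>"
  shows "flux' s \<ge> integral {a..b} (\<lambda>t. (vs s t)\<^sup>2) + integral {a..b} (\<lambda>t. (vt s t)\<^sup>2)"
proof -
  have nT: "a \<notin> T s" "b \<notin> T s"
  proof -
    have "T s \<subseteq> {a<..<b}" using T[OF s] interior_maximal[of "T s" "{a..b}"] by simp
    then show "a \<notin> T s" "b \<notin> T s" by auto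
  qed
  have "((\<lambda>t. (vt s t)\<^sup>2 + v s t * vtt s t) has_integral v s b * vt s b - v s a * vt s a) {a..b}"
  proof (rule fundamental_theorem_of_calculus[OF ab])
    fix t
    have "((\<lambda>t. v s t * vt s t) has_real_derivative (vt s t)\<^sup>2 + v s t * vtt s t) (at t within {a..b})"
      using has_field_derivative_at_within[OF DERIV_mult[OF dt[OF s, of t] dtt[OF s, of t]], of "{a..b}"]
      by (simp add: power2_eq_square algebra_simps)
    then show "((\<lambda>t. v s t * vt s t) has_vector_derivative (vt s t)\<^sup>2 + v s t * vtt s t) (at t within {a..b})"
      by (simp add: has_real_derivative_iff_has_vector_derivative)
  qed
  from integral_unique[OF this] have parts: "integral {a..b} (\<lambda>t. (vt s t)\<^sup>2 + v s t * vtt s t) = 0"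
    by (simp add: zero[OF s nT(1)] zero[OF s nT(2)])
  have int: "(\<lambda>t. (vs s t)\<^sup>2) integrable_on {a..b}" "(\<lambda>t. (vt s t)\<^sup>2) integrable_on {a..b}"
      "(\<lambda>t. v s t * vss s t) integrable_on {a..b}" "(\<lambda>t. v s t * vtt s t) integrable_on {a..b}"
    using s by (intro integrable_continuous_interval continuous_intros cont_fst; simp)+
  have "0 \<le> integral {a..b} (\<lambda>t. v s t * vss s t + v s t * vtt s t)"
  proof (intro integral_nonneg integrable_add int)
    show "0 \<le> v s t * vss s t + v s t * vtt s t" for t
      using mult_nonneg_nonneg[OF nonneg[OF s] laplacian[OF s], of t t] by (simp only: distrib_left)
  qed
  then show ?thesis
    using parts unfolding flux'_def integral_add[OF int(1,3)] integral_add[OF int(2,4)] integral_add[OF int(3,4)]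
    by linarith
qed

text \<open>Wirtinger turns the \<open>vt\<close> energy into \<open>c\<^sup>2\<close> times the
  mean square of \<open>v\<close>; the \<open>vs\<close> energy is then combined with it through
  \<open>2 * x * y \<le> x\<^sup>2 + y\<^sup>2\<close>.\<close>

lemma flux'_ge_length:
  assumes s: "\<alpha> < s" "s < \<beta>" and l: "len s > 0"
  shows "flux' s \<ge> 2 * (pi / len s) * flux s"
proof -
  define c where "c = pi / len s"
  have int: "(\<lambda>t. (vs s t)\<^sup>2) integrable_on {a..b}" "(\<lambda>t. (v s t)\<^sup>2) integrable_on {a..b}"
      "(\<lambda>t. v s t * vs s t) integrable_on {a..b}"
    using s by (intro integrable_continuous_interval continuous_intros cont_fst; simp)+
  have "pi\<^sup>2 * integral {a..b} (\<lambda>t. (v s t)\<^sup>2) \<le> (len s)\<^sup>2 * integral {a..b} (\<lambda>t. (vt s t)\<^sup>2)"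
    using T[OF s] ab dt[OF s] cont_fst(4)[OF s] zero[OF s] by (rule wirtinger_open)
  then have w: "c\<^sup>2 * integral {a..b} (\<lambda>t. (v s t)\<^sup>2) \<le> integral {a..b} (\<lambda>t. (vt s t)\<^sup>2)"
    using l by (simp add: c_def power_divide pos_divide_le_eq mult.commute)
  have "2 * c * flux s = integral {a..b} (\<lambda>t. 2 * c * (v s t * vs s t))"
    by (simp add: flux_def)
  also have "\<dots> \<le> integral {a..b} (\<lambda>t. (vs s t)\<^sup>2 + c\<^sup>2 * (v s t)\<^sup>2)"
  proof (rule integral_le)
    fix t
    have "0 \<le> (vs s t - c * v s t)\<^sup>2" by simp
    then show "2 * c * (v s t * vs s t) \<le> (vs s t)\<^sup>2 + c\<^sup>2 * (v s t)\<^sup>2"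
      by (simp add: power2_eq_square algebra_simps)
  qed (intro integrable_add integrable_on_mult_right int)+
  also have "\<dots> = integral {a..b} (\<lambda>t. (vs s t)\<^sup>2) + c\<^sup>2 * integral {a..b} (\<lambda>t. (v s t)\<^sup>2)"
    by (simp add: integral_add[OF int(1) integrable_on_mult_right[OF int(2)]])
  also have "\<dots> \<le> flux' s" using w flux'_ge_energy[OF s] by simp
  finally show ?thesis by (simp add: c_def)
qed

text \<open>Cauchy-Schwarz for a function that rises by \<open>c\<close> over a length at most
  \<open>l\<close>. The bound does not depend on the sign of \<open>flux\<close>, so it can drive an
  initially negative flux above zero.\<close>

lemma flux'_ge_oscillation:
  assumes s: "\<alpha> < s" "s < \<beta>" and x: "v s x = 0" "v s y \<ge> c" "a \<le> x" "x \<le> y" "y \<le> b" "y - x \<le> l"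
    and l: "l > 0" and c: "c \<ge> 0"
  shows "flux' s \<ge> c\<^sup>2 / l"
proof -
  \<comment> \<open>The slope of the linear function with the same rise and length, for which
    \<open>2 * k * vt \<le> k\<^sup>2 + vt\<^sup>2\<close> is an equality.\<close>
  define k where "k = c / l"
  have vt: "(vt s has_integral v s y - v s x) {x..y}"
    using dt[OF s] x by (intro fundamental_theorem_of_calculus)
      (auto simp: has_real_derivative_iff_has_vector_derivative intro: has_vector_derivative_at_within)
  have int: "(\<lambda>t. (vt s t)\<^sup>2) integrable_on A" if "A = {a..b} \<or> A = {x..y}" for A
    using that s by (auto intro!: integrable_continuous_interval continuous_intros cont_fst)
  have "2 * k * (v s y - v s x) = integral {x..y} (\<lambda>t. 2 * k * vt s t)"
    using vt by (simp add: integral_unique)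
  also have "\<dots> \<le> integral {x..y} (\<lambda>t. k\<^sup>2 + (vt s t)\<^sup>2)"
  proof (rule integral_le)
    fix t
    have "0 \<le> (vt s t - k)\<^sup>2" by simp
    then show "2 * k * vt s t \<le> k\<^sup>2 + (vt s t)\<^sup>2"
      by (simp add: power2_eq_square algebra_simps)
  qed (use int vt in \<open>auto intro!: integrable_add integrable_on_mult_right\<close>)
  also have "\<dots> = (y - x) * k\<^sup>2 + integral {x..y} (\<lambda>t. (vt s t)\<^sup>2)"
    using int x by (subst integral_add) auto
  also have "\<dots> \<le> l * k\<^sup>2 + integral {a..b} (\<lambda>t. (vt s t)\<^sup>2)"
    using x int by (intro add_mono mult_right_mono integral_subset_le) auto
  finally have *: "2 * k * (v s y - v s x) - l * k\<^sup>2 \<le> integral {a..b} (\<lambda>t. (vt s t)\<^sup>2)" by simp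
  have "c\<^sup>2 / l = 2 * k * c - l * k\<^sup>2"
    using l by (simp add: k_def power2_eq_square)
  also have "\<dots> \<le> 2 * k * (v s y - v s x) - l * k\<^sup>2"
    using x l c by (auto simp: k_def intro!: divide_right_mono mult_left_mono)
  also note *
  also have "integral {a..b} (\<lambda>t. (vt s t)\<^sup>2) \<le> flux' s"
  proof -
    have "integral {a..b} (\<lambda>t. (vs s t)\<^sup>2) \<ge> 0"
      using s by (intro integral_nonneg integrable_continuous_interval continuous_intros cont_fst) auto
    then show ?thesis using flux'_ge_energy[OF s] by simp
  qed
  finally show ?thesis .
qed

lemma sq_mean_nonneg:
  assumes s: "\<alpha> < s" "s < \<beta>"
  shows "sq_mean s \<ge> 0"
  unfolding sq_mean_def using s
  by (intro integral_nonneg integrable_continuous_interval continuous_intros cont_fst) auto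

lemma sq_mean_le:
  assumes s: "\<alpha> < s" "s < \<beta>" and C: "\<And>t. v s t \<le> C" and l: "len s \<le> l"
  shows "sq_mean s \<le> C\<^sup>2 * l"
proof -
  have "sq_mean s \<le> C\<^sup>2 * len s"
    unfolding sq_mean_def using s zero[OF s] nonneg[OF s] C
    by (intro integral_le_support_measure T continuous_intros cont_fst) (auto intro!: power_mono)
  also have "\<dots> \<le> C\<^sup>2 * l" using l by (intro mult_left_mono) auto
  finally show ?thesis .
qed

lemma flux_ge:
  assumes s: "\<alpha> < s" "s < \<beta>" and C: "\<And>t. \<bar>v s t * vs s t\<bar> \<le> C" and l: "len s \<le> l"
  shows "flux s \<ge> - (C * l)"
proof -
  have "integral {a..b} (\<lambda>t. - (v s t * vs s t)) \<le> C * len s"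
  proof (intro integral_le_support_measure T continuous_intros cont_fst s)
    show "- (v s t * vs s t) \<le> C" for t using C[of t] by linarith
  qed (use zero[OF s] in auto)
  moreover have "C * len s \<le> C * l" using l C[of 0] by (intro mult_left_mono) auto
  ultimately show ?thesis by (simp add: flux_def)
qed

end

section \<open>Subharmonic potentials from holomorphic functions\<close>

text \<open>A \<open>C\<^sup>2\<close> substitute for \<open>log\<^sup>+\<close>: \<open>softlog t = \<psi> (ln t)\<close> for \<open>t \<ge> 1\<close>, where \<open>\<psi> x = x - 2 + (x + 2) e\<^bsup>-x\<^esup>\<close>
  solves \<open>\<psi>'' x = x e\<^bsup>-x\<^esup>\<close> with zero initial values. Convexity of \<open>\<psi>\<close> is what makes \<open>softlog \<bar>h\<bar>\<^sup>2\<close>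
  subharmonic, and its asymptotic slope 1 keeps the growth of \<open>log \<bar>h\<bar>\<^sup>2\<close>.\<close>

definition softlog :: "real \<Rightarrow> real" where "softlog t = ln (max 1 t) - 2 + (ln (max 1 t) + 2) / max 1 t"
definition softlog_d1 :: "real \<Rightarrow> real" where "softlog_d1 t = (max 1 t - 1 - ln (max 1 t)) / (max 1 t)\<^sup>2"
definition softlog_d2 :: "real \<Rightarrow> real" where "softlog_d2 t = (1 - max 1 t + 2 * ln (max 1 t)) / (max 1 t) ^ 3"

lemma softlog_zero: "t \<le> 1 \<Longrightarrow> softlog t = 0" "t \<le> 1 \<Longrightarrow> softlog_d1 t = 0" "t \<le> 1 \<Longrightarrow> softlog_d2 t = 0"
  by (auto simp: softlog_def softlog_d1_def softlog_d2_def max_absorb1)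

lemma continuous_softlog: "continuous_on S softlog" "continuous_on S softlog_d1" "continuous_on S softlog_d2"
  unfolding softlog_def softlog_d1_def softlog_d2_def by (auto intro!: continuous_intros)

text \<open>To the left of 1 the function is constant zero, to the right it is \<open>g\<close>. At
  1 itself it is \<open>g\<close> times a step function, and \<open>g\<close> has a double zero
  there.\<close>

lemma has_real_derivative_max1:
  fixes g g' :: "real \<Rightarrow> real"
  assumes "\<And>t. t \<ge> 1 \<Longrightarrow> (g has_real_derivative g' t) (at t)" "g 1 = 0" "g' 1 = 0"
  shows "((\<lambda>t. g (max 1 t)) has_real_derivative g' (max 1 t)) (at t)"
proof -
  consider "t < 1" | "t = 1" | "t > 1" by linarith
  then show ?thesis
  proof cases
    case 1
    have "((\<lambda>t. g (max 1 t)) has_real_derivative 0) (at t)"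
      by (rule has_field_derivative_transform_within_open[of "\<lambda>_. 0" _ _ "{..<1}"])
        (use 1 assms(2) in \<open>auto simp: max_absorb1\<close>)
    then show ?thesis using 1 assms(3) by (simp add: max_absorb1)
  next
    case 2
    have "((\<lambda>t. g t * (if t \<le> 1 then 0 else 1)) has_real_derivative 0) (at t)"
      using assms(1)[of 1] assms(2,3) 2 by (intro has_real_derivative_mult_bounded[of _ _ _ 1]) auto
    moreover have "(\<lambda>t. g t * (if t \<le> 1 then 0 else 1)) = (\<lambda>t. g (max 1 t))"
      using assms(2) by (auto simp: fun_eq_iff max_def)
    ultimately show ?thesis using 2 assms(3) by simp
  next
    case 3
    have "((\<lambda>t. g (max 1 t)) has_real_derivative g' t) (at t)"
      by (rule has_field_derivative_transform_within_open[of g _ _ "{1<..}"])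
        (use 3 assms(1) in \<open>auto simp: max_absorb2\<close>)
    then show ?thesis using 3 by (simp add: max_absorb2)
  qed
qed

lemma softlog_deriv: "(softlog has_real_derivative softlog_d1 t) (at t)"
  unfolding softlog_def[abs_def] softlog_d1_def
proof (rule has_real_derivative_max1)
  fix t :: real assume t: "t \<ge> 1"
  have "((\<lambda>t. ln t - 2 + (ln t + 2) / t) has_real_derivative
      1 / t + (1 / t * t - (ln t + 2) * 1) / (t * t)) (at t)"
    using t by (auto intro!: derivative_eq_intros)
  then show "((\<lambda>t. ln t - 2 + (ln t + 2) / t) has_real_derivative (t - 1 - ln t) / t\<^sup>2) (at t)"
    by (rule DERIV_cong) (use t in \<open>simp add: field_simps power2_eq_square\<close>)
qed auto

lemma softlog_d1_deriv: "(softlog_d1 has_real_derivative softlog_d2 t) (at t)"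
  unfolding softlog_d1_def[abs_def] softlog_d2_def
proof (rule has_real_derivative_max1)
  fix t :: real assume t: "t \<ge> 1"
  have "((\<lambda>t. (t - 1 - ln t) / t\<^sup>2) has_real_derivative
      ((1 - 1 / t) * t\<^sup>2 - (t - 1 - ln t) * (2 * t)) / (t\<^sup>2 * t\<^sup>2)) (at t)"
    using t by (auto intro!: derivative_eq_intros)
  then show "((\<lambda>t. (t - 1 - ln t) / t\<^sup>2) has_real_derivative (1 - t + 2 * ln t) / t ^ 3) (at t)"
    by (rule DERIV_cong) (use t in \<open>simp add: field_simps power2_eq_square power3_eq_cube\<close>)
qed auto

lemma softlog_d1_nonneg: "softlog_d1 t \<ge> 0"
  using ln_le_minus_one[of "max 1 t"] by (auto simp: softlog_d1_def intro!: divide_nonneg_nonneg)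

lemma softlog_mono: "x \<le> y \<Longrightarrow> softlog x \<le> softlog y"
  using softlog_deriv softlog_d1_nonneg by (intro DERIV_nonneg_imp_nondecreasing[of x y softlog]) auto

lemma softlog_nonneg: "softlog t \<ge> 0"
  using softlog_mono[of "min 1 t" t] softlog_zero(1)[of "min 1 t"] by simp

lemma softlog_le_ln: "softlog t \<le> ln (max 1 t)"
proof -
  have "ln (max 1 t) + 2 \<le> 2 * max 1 t" using ln_le_minus_one[of "max 1 t"] by linarith
  then have "(ln (max 1 t) + 2) / max 1 t \<le> 2" by (simp add: pos_divide_le_eq)
  then show ?thesis by (simp add: softlog_def)
qed

lemma softlog_pos:
  assumes "t > 1"
  shows "softlog t > 0"
proof -
  have "softlog 1 < softlog t"
  proof (rule DERIV_pos_imp_increasing_open[OF assms])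
    fix x :: real assume "1 < x"
    then have "softlog_d1 x > 0" using ln_less_self[of x] ln_eq_minus_one[of x] ln_le_minus_one[of x]
      by (auto simp: softlog_d1_def max_absorb2 less_le intro!: divide_pos_pos)
    then show "\<exists>y. (softlog has_real_derivative y) (at x) \<and> 0 < y" using softlog_deriv by blast
  qed (auto intro: continuous_softlog)
  then show ?thesis by (simp add: softlog_zero)
qed

text \<open>Up to the factor \<open>4 * (cmod (deriv h z))\<^sup>2\<close> this is the Laplacian of
  \<open>softlog\<close> applied to the squared modulus of \<open>h\<close>. For
  \<open>t > 1\<close> it equals \<open>ln t / t\<^sup>2\<close>, which is the convexity of the
  profile in the variable \<open>ln t\<close>.\<close>

lemma softlog_laplacian: "t * softlog_d2 t + softlog_d1 t \<ge> 0"
proof (cases "t \<le> 1")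
  case False
  then have "t * softlog_d2 t + softlog_d1 t = ln t / t\<^sup>2"
    by (simp add: softlog_d1_def softlog_d2_def max_absorb2 divide_simps power2_eq_square power3_eq_cube)
  then show ?thesis using False by simp
qed (simp add: softlog_zero)

section \<open>Potentials of holomorphic functions, extended by zero\<close>

definition cutoff :: "complex set \<Rightarrow> (complex \<Rightarrow> real) \<Rightarrow> real \<Rightarrow> real \<Rightarrow> real" where
  "cutoff D E s t = (if Complex s t \<in> D then E (Complex s t) else 0)"

context
  fixes h :: "complex \<Rightarrow> complex"
  assumes hol: "h holomorphic_on UNIV"
begin

definition normsq :: "complex \<Rightarrow> real" where "normsq z = (Re (h z))\<^sup>2 + (Im (h z))\<^sup>2"

text \<open>\<open>normsq_d1 w\<close> and \<open>potential_d1 w\<close> are derivatives in the direction \<open>w\<close>; only \<open>w = 1\<close> and \<open>w = \<i>\<close> occur.\<close>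

definition normsq_d1 :: "complex \<Rightarrow> complex \<Rightarrow> real" where
  "normsq_d1 w z = 2 * (Re (h z) * Re (w * deriv h z) + Im (h z) * Im (w * deriv h z))"

definition normsq_d2 :: "complex \<Rightarrow> complex \<Rightarrow> real" where
  "normsq_d2 w z = 2 * ((Re (w * deriv h z))\<^sup>2 + (Im (w * deriv h z))\<^sup>2 +
     Re (h z) * Re (w * (w * deriv (deriv h) z)) + Im (h z) * Im (w * (w * deriv (deriv h) z)))"

definition potential :: "complex \<Rightarrow> real" where "potential z = softlog (normsq z)"
definition potential_d1 :: "complex \<Rightarrow> complex \<Rightarrow> real" where "potential_d1 w z = softlog_d1 (normsq z) * normsq_d1 w z"
definition potential_d2 :: "complex \<Rightarrow> complex \<Rightarrow> real" where
  "potential_d2 w z = softlog_d2 (normsq z) * (normsq_d1 w z)\<^sup>2 + softlog_d1 (normsq z) * normsq_d2 w z"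

lemma normsq_eq: "normsq z = (cmod (h z))\<^sup>2"
  by (simp add: normsq_def cmod_power2)

lemma hol_deriv: "deriv h holomorphic_on UNIV" "deriv (deriv h) holomorphic_on UNIV"
  using hol by (auto intro!: holomorphic_deriv)

lemma cont_derivs: "continuous_on S h" "continuous_on S (deriv h)" "continuous_on S (deriv (deriv h))"
  using hol hol_deriv by (meson continuous_on_subset holomorphic_on_imp_continuous_on subset_UNIV)+

lemma continuous_potential: "continuous_on S potential" "continuous_on S (potential_d1 w)" "continuous_on S (potential_d2 w)"
proof -
  have q: "continuous_on S normsq" "continuous_on S (normsq_d1 w)" "continuous_on S (normsq_d2 w)"
    unfolding normsq_def[abs_def] normsq_d1_def[abs_def] normsq_d2_def[abs_def] by (intro continuous_intros cont_derivs)+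
  have c: "continuous_on S (\<lambda>z. softlog (normsq z))" "continuous_on S (\<lambda>z. softlog_d1 (normsq z))" "continuous_on S (\<lambda>z. softlog_d2 (normsq z))"
    using continuous_on_compose2[OF continuous_softlog(1)[of UNIV] q(1)]
      continuous_on_compose2[OF continuous_softlog(2)[of UNIV] q(1)]
      continuous_on_compose2[OF continuous_softlog(3)[of UNIV] q(1)] by auto
  show "continuous_on S potential" "continuous_on S (potential_d1 w)" "continuous_on S (potential_d2 w)"
    unfolding potential_def[abs_def] potential_d1_def[abs_def] potential_d2_def[abs_def] by (intro continuous_intros c q)+
qed

lemma potential_zero: "cmod (h z) < 1 \<Longrightarrow> potential z = 0" "cmod (h z) < 1 \<Longrightarrow> potential_d1 w z = 0" "cmod (h z) < 1 \<Longrightarrow> potential_d2 w z = 0"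
proof -
  assume "cmod (h z) < 1"
  then have "normsq z \<le> 1" by (simp add: normsq_eq power_le_one)
  then show "potential z = 0" "potential_d1 w z = 0" "potential_d2 w z = 0" by (auto simp: potential_def potential_d1_def potential_d2_def softlog_zero)
qed

text \<open>The terms with the second derivative of \<open>h\<close> cancel because the squares of
  the directions 1 and \<open>\<i>\<close> add up to 0. The squared first derivatives of
  \<open>normsq\<close> add up to 4 times \<open>normsq\<close> times the squared modulus of the
  derivative of \<open>h\<close>.\<close>

lemma potential_laplacian: "potential_d2 1 z + potential_d2 \<i> z \<ge> 0"
proof -
  have "potential_d2 1 z + potential_d2 \<i> z = 4 * (cmod (deriv h z))\<^sup>2 * (normsq z * softlog_d2 (normsq z) + softlog_d1 (normsq z))"
  proof -
    define p1 p2 where "p1 = softlog_d1 (normsq z)" and "p2 = softlog_d2 (normsq z)"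
    show ?thesis
      unfolding potential_d2_def p1_def[symmetric] p2_def[symmetric] cmod_power2
      by (simp add: normsq_d1_def normsq_d2_def normsq_def power2_eq_square algebra_simps)
  qed
  then show ?thesis using softlog_laplacian[of "normsq z"] by simp
qed

lemma potential_deriv:
  fixes c :: "real \<Rightarrow> complex"
  assumes c: "(c has_vector_derivative w) (at u)"
  shows "((\<lambda>u. potential (c u)) has_real_derivative potential_d1 w (c u)) (at u)"
    and "((\<lambda>u. potential_d1 w (c u)) has_real_derivative potential_d2 w (c u)) (at u)"
proof -
  have comp: "((\<lambda>u. Re (g (c u))) has_real_derivative Re (w * deriv g (c u))) (at u)"
     "((\<lambda>u. Im (g (c u))) has_real_derivative Im (w * deriv g (c u))) (at u)"
    if "g holomorphic_on UNIV" for g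
  proof -
    have "(g has_field_derivative deriv g (c u)) (at (c u))"
      using that by (auto intro: holomorphic_derivI)
    from field_vector_diff_chain_at[OF c this]
    have "((\<lambda>u. g (c u)) has_vector_derivative w * deriv g (c u)) (at u)" by (simp add: o_def)
    then show "((\<lambda>u. Re (g (c u))) has_real_derivative Re (w * deriv g (c u))) (at u)"
       "((\<lambda>u. Im (g (c u))) has_real_derivative Im (w * deriv g (c u))) (at u)"
      using bounded_linear.has_vector_derivative[OF bounded_linear_Re]
        bounded_linear.has_vector_derivative[OF bounded_linear_Im]
      unfolding has_real_derivative_iff_has_vector_derivative by blast+
  qed
  have w': "((\<lambda>u. Re (w * deriv h (c u))) has_real_derivative Re (w * (w * deriv (deriv h) (c u)))) (at u)"
    "((\<lambda>u. Im (w * deriv h (c u))) has_real_derivative Im (w * (w * deriv (deriv h) (c u)))) (at u)"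
  proof -
    have hw: "(\<lambda>z. w * deriv h z) holomorphic_on UNIV" by (intro holomorphic_intros hol_deriv)
    have dw: "deriv (\<lambda>z. w * deriv h z) (c u) = w * deriv (deriv h) (c u)"
      using hol_deriv(1) by (simp add: holomorphic_on_imp_differentiable_at)
    show "((\<lambda>u. Re (w * deriv h (c u))) has_real_derivative Re (w * (w * deriv (deriv h) (c u)))) (at u)"
      "((\<lambda>u. Im (w * deriv h (c u))) has_real_derivative Im (w * (w * deriv (deriv h) (c u)))) (at u)"
      using comp[OF hw] unfolding dw .
  qed
  have q: "((\<lambda>u. normsq (c u)) has_real_derivative normsq_d1 w (c u)) (at u)"
    unfolding normsq_def normsq_d1_def by (rule derivative_eq_intros comp[OF hol] refl)+ simp
  have q1: "((\<lambda>u. normsq_d1 w (c u)) has_real_derivative normsq_d2 w (c u)) (at u)"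
    unfolding normsq_d1_def normsq_d2_def
    by (rule derivative_eq_intros comp[OF hol] w' refl)+ (simp add: power2_eq_square algebra_simps)
  show "((\<lambda>u. potential (c u)) has_real_derivative potential_d1 w (c u)) (at u)"
    unfolding potential_def potential_d1_def by (rule DERIV_chain2[OF softlog_deriv q])
  show "((\<lambda>u. potential_d1 w (c u)) has_real_derivative potential_d2 w (c u)) (at u)"
    using DERIV_mult[OF DERIV_chain2[OF softlog_d1_deriv q] q1]
    unfolding potential_d1_def potential_d2_def by (simp add: power2_eq_square algebra_simps)
qed

text \<open>At a frontier point of \<open>D\<close> in the strip the potential and its derivatives
  vanish on a whole neighbourhood, since the set where \<open>h\<close> has modulus below 1 is open.
  So every cut off function agrees locally with the uncut one or with zero, and no regularity is
  lost.\<close>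

lemma subharmonic_strip_cutoff:
  assumes D: "open D" and L: "L \<ge> 0"
    and fr: "\<And>z. \<alpha> < Re z \<Longrightarrow> Re z < \<beta> \<Longrightarrow> z \<in> closure D \<Longrightarrow> z \<notin> D \<Longrightarrow> cmod (h z) < 1"
    and bd: "\<And>z. z \<in> D \<Longrightarrow> \<bar>Im z\<bar> \<le> L"
  shows "subharmonic_strip (cutoff D potential) (cutoff D (potential_d1 1)) (cutoff D (potential_d2 1)) (cutoff D (potential_d1 \<i>)) (cutoff D (potential_d2 \<i>))
    \<alpha> \<beta> (- L) L (\<lambda>s. {t. Complex s t \<in> D})"
proof -
  have loc: "\<exists>N. open N \<and> z \<in> N \<and> (z \<in> D \<and> N \<subseteq> D \<or> z \<notin> D \<and> (\<forall>w\<in>N. w \<in> D \<longrightarrow> cmod (h w) < 1))"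
    if z: "\<alpha> < Re z" "Re z < \<beta>" for z
  proof -
    consider "z \<in> D" | "z \<notin> closure D" | "z \<notin> D" "cmod (h z) < 1"
      using fr z by blast
    then show ?thesis
    proof cases
      case 1
      then show ?thesis using D by blast
    next
      case 2
      then have "open (- closure D)" "z \<in> - closure D" "z \<notin> D" using closure_subset by auto
      moreover have "\<forall>w\<in>- closure D. w \<in> D \<longrightarrow> cmod (h w) < 1" using closure_subset by auto
      ultimately show ?thesis by blast
    next
      case 3
      have "open {w. cmod (h w) < 1}" by (intro open_Collect_less continuous_intros cont_derivs)
      then show ?thesis using 3 by blast
    qed
  qed
  define C where "C = (\<lambda>E z. if z \<in> D then E z else (0::real))"
  have cutC: "cutoff D E s t = C E (Complex s t)" for E s t by (simp add: cutoff_def C_def)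
  have contC: "continuous_on {z. \<alpha> < Re z \<and> Re z < \<beta>} (C E)"
    if E: "continuous_on UNIV E" "\<And>z. cmod (h z) < 1 \<Longrightarrow> E z = 0" for E
  proof (rule continuous_at_imp_continuous_on, rule ballI)
    fix z assume "z \<in> {z. \<alpha> < Re z \<and> Re z < \<beta>}"
    then obtain N where N: "open N" "z \<in> N" "z \<in> D \<and> N \<subseteq> D \<or> z \<notin> D \<and> (\<forall>w\<in>N. w \<in> D \<longrightarrow> cmod (h w) < 1)"
      using loc by blast
    have "\<forall>w\<in>N. C E w = (if z \<in> D then E w else 0)" using N(3) E(2) by (auto simp: C_def)
    then have "isCont (C E) z \<longleftrightarrow> isCont (\<lambda>w. if z \<in> D then E w else 0) z"
      using N by (intro isCont_cong) (auto simp: eventually_nhds)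
    moreover have "isCont E z" using E(1) by (simp add: continuous_on_eq_continuous_at)
    ultimately show "isCont (C E) z" by (cases "z \<in> D") auto
  qed
  have contcut: "continuous_on ({\<alpha><..<\<beta>} \<times> UNIV) (\<lambda>(s, t). cutoff D E s t)"
    if E: "continuous_on UNIV E" "\<And>z. cmod (h z) < 1 \<Longrightarrow> E z = 0" for E
    unfolding cutC case_prod_unfold
    by (rule continuous_on_compose2[OF contC[OF E]]) (auto simp: Complex_eq intro!: continuous_intros)
  have derC: "((\<lambda>u. C E (c u)) has_real_derivative C E' (c u)) (at u)"
    if c: "continuous_on UNIV c" "\<alpha> < Re (c u)" "Re (c u) < \<beta>"
      and E: "((\<lambda>u. E (c u)) has_real_derivative E' (c u)) (at u)" "\<And>z. cmod (h z) < 1 \<Longrightarrow> E z = 0"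
    for E E' c u
  proof -
    obtain N where N: "open N" "c u \<in> N" "c u \<in> D \<and> N \<subseteq> D \<or> c u \<notin> D \<and> (\<forall>w\<in>N. w \<in> D \<longrightarrow> cmod (h w) < 1)"
      using loc[OF c(2,3)] by blast
    have op: "open (c -` N)" using N c(1) by (intro open_vimage)
    show ?thesis
    proof (cases "c u \<in> D")
      case True
      show ?thesis
        by (rule has_field_derivative_transform_within_open[OF _ op, of "\<lambda>u. E (c u)"])
          (use E(1) True N in \<open>auto simp: C_def\<close>)
    next
      case False
      show ?thesis
        by (rule has_field_derivative_transform_within_open[OF _ op, of "\<lambda>u. 0"])
          (use E(2) False N in \<open>auto simp: C_def\<close>)
    qed
  qed
  have cols: "continuous_on UNIV (\<lambda>s. Complex s t)" "continuous_on UNIV (\<lambda>t. Complex s t)" for s t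
    by (auto simp: Complex_eq intro!: continuous_intros)
  have vd: "((\<lambda>s. Complex s t) has_vector_derivative 1) (at s)"
    "((\<lambda>t. Complex s t) has_vector_derivative \<i>) (at t)" for s t
    unfolding Complex_eq by (auto intro!: derivative_eq_intros)
  show ?thesis
  proof
    show "- L \<le> L" using L by simp
    fix s t assume s: "\<alpha> < s" "s < \<beta>"
    show "((\<lambda>s. cutoff D potential s t) has_real_derivative cutoff D (potential_d1 1) s t) (at s)"
      "((\<lambda>s. cutoff D (potential_d1 1) s t) has_real_derivative cutoff D (potential_d2 1) s t) (at s)"
      "((\<lambda>t. cutoff D potential s t) has_real_derivative cutoff D (potential_d1 \<i>) s t) (at t)"
      "((\<lambda>t. cutoff D (potential_d1 \<i>) s t) has_real_derivative cutoff D (potential_d2 \<i>) s t) (at t)"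
      unfolding cutC using s
      by (auto intro!: derC cols potential_deriv vd potential_zero)
    show "cutoff D potential s t \<ge> 0" by (simp add: cutoff_def potential_def softlog_nonneg)
    show "cutoff D (potential_d2 1) s t + cutoff D (potential_d2 \<i>) s t \<ge> 0" by (simp add: cutoff_def potential_laplacian)
    show "t \<notin> {t. Complex s t \<in> D} \<Longrightarrow> cutoff D potential s t = 0" by (simp add: cutoff_def)
  next
    fix s
    show "open {t. Complex s t \<in> D}"
      using open_vimage[OF D cols(2)] by (simp add: vimage_def)
    show "{t. Complex s t \<in> D} \<subseteq> {- L..L}" using bd by force
  qed (intro contcut continuous_potential potential_zero; simp)+
qed

end

section \<open>Regions between disjoint curves\<close>

text \<open>The Fashoda meet theorem, transported from \<open>real^2\<close> by the coordinate map
  \<open>F\<close>: a path from left to right in a rectangle meets one from bottom to top.\<close>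

lemma fashoda_complex:
  fixes f g :: "real \<Rightarrow> complex"
  assumes "path f" "path g"
    and f: "\<And>z. z \<in> path_image f \<Longrightarrow> a \<le> Re z \<and> Re z \<le> b \<and> c \<le> Im z \<and> Im z \<le> d"
    and g: "\<And>z. z \<in> path_image g \<Longrightarrow> a \<le> Re z \<and> Re z \<le> b \<and> c \<le> Im z \<and> Im z \<le> d"
    and "Re (pathstart f) = a" "Re (pathfinish f) = b" "Im (pathstart g) = c" "Im (pathfinish g) = d"
  obtains z where "z \<in> path_image f" "z \<in> path_image g"
proof -
  define F :: "complex \<Rightarrow> real^2" where "F = (\<lambda>z. \<chi> i. if i = 1 then Re z else Im z)"
  have F: "F z $ 1 = Re z" "F z $ 2 = Im z" for z by (auto simp: F_def)
  have cont: "continuous_on S F" for S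
  proof -
    have "continuous_on S (\<lambda>z. if i = 1 then Re z else Im z)" for i :: 2
      by (cases "i = 1") (auto intro!: continuous_intros)
    then show ?thesis unfolding F_def by (rule continuous_on_vec_lambda)
  qed
  define lo hi :: "real^2" where "lo = F (Complex a c)" and "hi = F (Complex b d)"
  have sub: "path_image (F \<circ> h) \<subseteq> cbox lo hi"
    if "\<And>z. z \<in> path_image h \<Longrightarrow> a \<le> Re z \<and> Re z \<le> b \<and> c \<le> Im z \<and> Im z \<le> d" for h
    using that by (auto simp: path_image_compose mem_box_cart forall_2 F lo_def hi_def)
  obtain w where "w \<in> path_image (F \<circ> f)" "w \<in> path_image (F \<circ> g)"
  proof (rule fashoda[of "F \<circ> f" "F \<circ> g" lo hi])
    show "path (F \<circ> f)" "path (F \<circ> g)"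
      using assms(1,2) cont by (auto intro!: path_continuous_image)
    show "path_image (F \<circ> f) \<subseteq> cbox lo hi" "path_image (F \<circ> g) \<subseteq> cbox lo hi"
      using f g by (intro sub; blast)+
  qed (use assms(5-8) in \<open>auto simp: pathstart_compose pathfinish_compose F lo_def hi_def\<close>)
  then obtain z z' where z: "z \<in> path_image f" "z' \<in> path_image g" "F z = F z'"
    by (auto simp: path_image_compose)
  then have "z = z'" using F by (metis complex_eq_iff)
  then show ?thesis using that z by blast
qed

text \<open>The part of the half-plane \<open>Re z < s1\<close> above (\<open>sg = 1\<close>) or below (\<open>sg = -1\<close>) the barrier \<open>K\<close>.
  The column \<open>Re z = s0\<close> serves as the reference direction towards infinity.\<close>

definition side :: "real \<Rightarrow> real \<Rightarrow> real \<Rightarrow> complex set \<Rightarrow> complex set" where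
  "side sg s0 s1 K = {z. \<exists>Y0. \<forall>Y\<ge>Y0. connected_component ({z. Re z < s1} - K) z (Complex s0 (sg * Y))}"

text \<open>The single height \<open>y\<close> at which \<open>K\<close> meets the column \<open>Re z = s0\<close> is what orders disjoint barriers.\<close>

definition crossing :: "real \<Rightarrow> real \<Rightarrow> real \<Rightarrow> complex set \<Rightarrow> bool" where
  "crossing s0 s1 y K \<longleftrightarrow> closed K \<and> connected (K \<inter> {z. Re z < s1}) \<and> (\<exists>Y. \<forall>z\<in>K. \<bar>Im z\<bar> \<le> Y) \<and>
     (\<forall>t. Complex s0 t \<in> K \<longleftrightarrow> t = y) \<and> (\<forall>s. s0 < s \<longrightarrow> s < s1 \<longrightarrow> (\<exists>t. Complex s t \<in> K)) \<and>
     side 1 s0 s1 K \<inter> side (-1) s0 s1 K = {}"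

lemma sideD: "z \<in> side sg s0 s1 K \<Longrightarrow> Re z < s1 \<and> z \<notin> K"
  unfolding side_def using connected_component_in by fastforce

text \<open>A side is a union of components of the half-plane without \<open>K\<close>. Membership
  therefore spreads along connected sets that avoid \<open>K\<close>, which is how most points are
  located below.\<close>

lemma side_absorb:
  assumes "z \<in> side sg s0 s1 K" "connected S" "S \<subseteq> {z. Re z < s1} - K" "z \<in> S" "w \<in> S"
  shows "w \<in> side sg s0 s1 K"
proof -
  have "connected_component ({z. Re z < s1} - K) w z"
    using assms by (auto simp: connected_component_def)
  then show ?thesis
    using assms(1) connected_component_trans unfolding side_def by blast
qed

lemma open_halfplane_diff: "closed K \<Longrightarrow> open ({z. Re z < s1} - K)"
  by (intro open_Diff open_halfspace_Re_lt)

text \<open>A small ball around \<open>z\<close> avoids \<open>K\<close> and meets the side, hence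
  is absorbed by it. Consequently the frontier of a side within the half-plane lies on the barrier,
  where \<open>h\<close> will be small.\<close>

lemma side_frontier:
  assumes "closed K" "z \<in> closure (side sg s0 s1 K)" "Re z < s1" "z \<notin> K"
  shows "z \<in> side sg s0 s1 K"
proof -
  obtain e where e: "e > 0" "ball z e \<subseteq> {z. Re z < s1} - K"
    using open_halfplane_diff[OF assms(1)] assms(3,4) open_contains_ball by blast
  obtain w where "w \<in> side sg s0 s1 K" "w \<in> ball z e"
    using assms(2) e(1) by (metis closure_approachable dist_commute mem_ball)
  then show ?thesis using e side_absorb[of w sg s0 s1 K "ball z e" z] by auto
qed

lemma side_open:
  assumes "closed K"
  shows "open (side sg s0 s1 K)"
  unfolding open_contains_ball
proof
  fix z assume z: "z \<in> side sg s0 s1 K"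
  then obtain e where e: "e > 0" "ball z e \<subseteq> {z. Re z < s1} - K"
    using open_halfplane_diff[OF assms] sideD open_contains_ball by blast
  then have "ball z e \<subseteq> side sg s0 s1 K" using z side_absorb[OF z, of "ball z e"] by auto
  with e show "\<exists>e>0. ball z e \<subseteq> side sg s0 s1 K" by blast
qed

lemma side_beyond:
  assumes "\<forall>z\<in>K. \<bar>Im z\<bar> \<le> Y" "\<bar>sg\<bar> = 1" "s0 < s1" "Re z < s1" "sg * Im z > Y"
  shows "z \<in> side sg s0 s1 K"
proof -
  define S where "S = {w. Re w < s1} \<inter> {w. inner (Complex 0 sg) w > Y}"
  have S: "S = {w. Re w < s1 \<and> sg * Im w > Y}" by (auto simp: S_def inner_complex_def)
  have "convex S"
    unfolding S_def by (intro convex_Int convex_halfspace_gt convex_halfspace_Re_lt)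
  then have "connected S" by (rule convex_connected)
  moreover have "S \<subseteq> {z. Re z < s1} - K" using assms(1,2) by (fastforce simp: S abs_if split: if_splits)
  moreover have "Complex s0 (sg * Y') \<in> S" if "Y' \<ge> Y + 1" for Y'
  proof -
    have "sg = 1 \<or> sg = -1" using assms(2) by (auto simp: abs_if split: if_splits)
    then show ?thesis using that assms(3) by (auto simp: S)
  qed
  moreover have "z \<in> S" using assms by (simp add: S)
  ultimately show ?thesis unfolding side_def connected_component_def by blast
qed

lemma connected_column: "connected (Complex s ` A)" if "connected A"
  using that by (intro connected_continuous_image) (auto simp: Complex_eq intro!: continuous_intros)

lemma side_column:
  assumes "\<forall>t. Complex s0 t \<in> K \<longleftrightarrow> t = y" "\<forall>z\<in>K. \<bar>Im z\<bar> \<le> Y" "\<bar>sg\<bar> = 1" "s0 < s1" "sg * (t - y) > 0"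
  shows "Complex s0 t \<in> side sg s0 s1 K"
proof -
  define A where "A = {t. sg * (t - y) > 0}"
  have "sg = 1 \<or> sg = -1" using assms(3) by (auto simp: abs_if split: if_splits)
  then have A: "A = {y<..} \<or> A = {..<y}" by (auto simp: A_def)
  define u where "u = sg * (\<bar>Y\<bar> + \<bar>y\<bar> + 1)"
  have u: "u \<in> A" "sg * u > Y" using \<open>sg = 1 \<or> sg = -1\<close> by (auto simp: A_def u_def)
  have "Complex s0 u \<in> side sg s0 s1 K"
    using u assms by (intro side_beyond[of K Y]) auto
  moreover have "connected (Complex s0 ` A)" using A by (intro connected_column) auto
  moreover have "Complex s0 ` A \<subseteq> {z. Re z < s1} - K" using assms A_def by auto
  ultimately show ?thesis using u(1) assms(5) side_absorb by (auto simp: A_def)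
qed

lemma side_disjoint:
  assumes "crossing s0 s1 y K" "\<bar>sg\<bar> = 1"
  shows "side sg s0 s1 K \<inter> side (- sg) s0 s1 K = {}"
proof -
  have "sg = 1 \<or> sg = -1" using assms(2) by (auto simp: abs_if split: if_splits)
  then show ?thesis using assms(1) by (auto simp: crossing_def)
qed

text \<open>\<open>K'\<close> is connected within the half-plane and avoids \<open>K\<close> there,
  so its single point on the column \<open>Re z = s0\<close> decides the side for all of it.\<close>

lemma crossing_subset_side:
  assumes K: "crossing s0 s1 y K" "crossing s0 s1 y' K'" and "K \<inter> K' \<inter> {z. Re z < s1} = {}"
    and sg: "\<bar>sg\<bar> = 1" "sg * (y' - y) > 0" and "s0 < s1"
  shows "K' \<inter> {z. Re z < s1} \<subseteq> side sg s0 s1 K"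
proof
  fix w assume w: "w \<in> K' \<inter> {z. Re z < s1}"
  have "Complex s0 y' \<in> side sg s0 s1 K"
    using K(1) sg \<open>s0 < s1\<close> by (auto simp: crossing_def intro!: side_column)
  then show "w \<in> side sg s0 s1 K"
  proof (rule side_absorb[OF _ _ _ _ w])
    show "connected (K' \<inter> {z. Re z < s1})" "Complex s0 y' \<in> K' \<inter> {z. Re z < s1}"
      using K(2) \<open>s0 < s1\<close> by (auto simp: crossing_def)
  qed (use assms(3) in auto)
qed

text \<open>A connected set that runs off to infinity on one side of \<open>K'\<close> cannot meet
  \<open>K\<close>, which lies on the opposite side, so it also witnesses membership in the side of
  \<open>K\<close>.\<close>

lemma side_mono:
  assumes K': "crossing s0 s1 y' K'" and sg: "\<bar>sg\<bar> = 1" and sub: "K \<inter> {z. Re z < s1} \<subseteq> side (- sg) s0 s1 K'"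
  shows "side sg s0 s1 K' \<subseteq> side sg s0 s1 K"
proof
  fix z assume z: "z \<in> side sg s0 s1 K'"
  then obtain Y0 where Y0: "\<And>Y. Y \<ge> Y0 \<Longrightarrow> connected_component ({z. Re z < s1} - K') z (Complex s0 (sg * Y))"
    by (auto simp: side_def)
  have "connected_component ({z. Re z < s1} - K) z (Complex s0 (sg * Y))" if "Y \<ge> Y0" for Y
  proof -
    obtain S where S: "connected S" "S \<subseteq> {z. Re z < s1} - K'" "z \<in> S" "Complex s0 (sg * Y) \<in> S"
      using Y0[of Y] \<open>Y \<ge> Y0\<close> by (auto simp: connected_component_def)
    then have "S \<subseteq> side sg s0 s1 K'" using side_absorb[OF z] by blast
    then have "S \<subseteq> {z. Re z < s1} - K"
      using sub side_disjoint[OF K' sg] S(2) by blast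
    then show ?thesis using S by (auto simp: connected_component_def)
  qed
  then show "z \<in> side sg s0 s1 K" by (auto simp: side_def)
qed

section \<open>Vertical translation of barriers\<close>

lemma connected_translation: "connected S \<Longrightarrow> connected ((+) (c::complex) ` S)"
  by (intro connected_continuous_image continuous_intros)

lemma connected_component_translation:
  assumes "connected_component A x y"
  shows "connected_component ((+) (c::complex) ` A) (c + x) (c + y)"
  using assms connected_translation unfolding connected_component_def by (metis imageI image_mono)

lemma halfplane_translation:
  assumes "Re c = 0"
  shows "(+) c ` ({z. Re z < s1} - K) = {z. Re z < s1} - (+) c ` K"
proof -
  have "(+) c ` {z. Re z < s1} = {z. Re z < s1}"
  proof safe
    fix z assume "Re z < s1"
    then show "z \<in> (+) c ` {z. Re z < s1}" using assms by (intro image_eqI[of _ _ "z - c"]) auto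
  qed (use assms in auto)
  moreover have "(+) c ` (A - B) = (+) c ` A - (+) c ` B" for A B :: "complex set"
    by auto
  ultimately show ?thesis by simp
qed

lemma side_translation_subset:
  assumes c: "Re c = 0" and "\<bar>sg\<bar> = 1" and z: "z \<in> side sg s0 s1 K"
  shows "c + z \<in> side sg s0 s1 ((+) c ` K)"
proof -
  obtain Y0 where Y0: "\<And>Y. Y \<ge> Y0 \<Longrightarrow> connected_component ({z. Re z < s1} - K) z (Complex s0 (sg * Y))"
    using z by (auto simp: side_def)
  have "connected_component ({z. Re z < s1} - (+) c ` K) (c + z) (Complex s0 (sg * Y))"
    if "Y \<ge> Y0 + \<bar>Im c\<bar>" for Y
  proof -
    have sg: "sg = 1 \<or> sg = -1" using assms(2) by (auto simp: abs_if split: if_splits)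
    have "c + Complex s0 (sg * (Y - sg * Im c)) = Complex s0 (sg * Y)"
      using c sg by (auto simp: complex_eq_iff algebra_simps)
    moreover have "Y - sg * Im c \<ge> Y0" using sg that by auto
    ultimately show ?thesis
      using connected_component_translation[OF Y0, of "Y - sg * Im c" c] halfplane_translation[OF c] by simp
  qed
  then show ?thesis unfolding side_def by blast
qed

lemma side_translation:
  assumes c: "Re c = 0" and sg: "\<bar>sg\<bar> = 1"
  shows "side sg s0 s1 ((+) c ` K) = (+) c ` side sg s0 s1 K"
proof
  show "(+) c ` side sg s0 s1 K \<subseteq> side sg s0 s1 ((+) c ` K)"
    using side_translation_subset[OF assms] by auto
  show "side sg s0 s1 ((+) c ` K) \<subseteq> (+) c ` side sg s0 s1 K"
  proof
    fix z assume "z \<in> side sg s0 s1 ((+) c ` K)"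
    then have "- c + z \<in> side sg s0 s1 ((+) (- c) ` (+) c ` K)"
      using side_translation_subset[of "- c" sg] c sg by auto
    then show "z \<in> (+) c ` side sg s0 s1 K"
      by (intro image_eqI[of _ _ "- c + z"]) (auto simp: image_image)
  qed
qed

lemma crossing_translation:
  assumes K: "crossing s0 s1 y K" and c: "Re c = 0"
  shows "crossing s0 s1 (y + Im c) ((+) c ` K)"
  unfolding crossing_def
proof (intro conjI allI impI)
  have mem: "Complex s t \<in> (+) c ` K \<longleftrightarrow> Complex s (t - Im c) \<in> K" for s t
  proof
    assume "Complex s (t - Im c) \<in> K"
    moreover have "Complex s t = c + Complex s (t - Im c)" using c by (simp add: complex_eq_iff)
    ultimately show "Complex s t \<in> (+) c ` K" by blast
  next
    assume "Complex s t \<in> (+) c ` K"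
    then obtain k where k: "k \<in> K" "Complex s t = c + k" by auto
    then have "k = Complex s (t - Im c)" using c by (auto simp: complex_eq_iff)
    then show "Complex s (t - Im c) \<in> K" using k by simp
  qed
  show "closed ((+) c ` K)" using K by (simp add: crossing_def closed_translation)
  have "(+) c ` (K \<inter> {z. Re z < s1}) = (+) c ` K \<inter> {z. Re z < s1}"
    using c by auto
  then show "connected ((+) c ` K \<inter> {z. Re z < s1})"
    using K connected_translation by (metis crossing_def)
  obtain Y where "\<forall>z\<in>K. \<bar>Im z\<bar> \<le> Y" using K by (auto simp: crossing_def)
  then have "\<forall>z\<in>(+) c ` K. \<bar>Im z\<bar> \<le> Y + \<bar>Im c\<bar>" by force
  then show "\<exists>Y. \<forall>z\<in>(+) c ` K. \<bar>Im z\<bar> \<le> Y" by blast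
  show "(Complex s0 t \<in> (+) c ` K) = (t = y + Im c)" for t
    using K by (auto simp: mem crossing_def)
  show "\<exists>t. Complex s t \<in> (+) c ` K" if "s0 < s" "s < s1" for s
  proof -
    obtain t where "Complex s t \<in> K" using K \<open>s0 < s\<close> \<open>s < s1\<close> by (auto simp: crossing_def)
    then have "Complex s (t + Im c) \<in> (+) c ` K" by (simp add: mem)
    then show ?thesis by blast
  qed
  show "side 1 s0 s1 ((+) c ` K) \<inter> side (- 1) s0 s1 ((+) c ` K) = {}"
    using K c by (auto simp: side_translation crossing_def)
qed

text \<open>The ray to the left completes the path to a barrier through the whole half-plane. If its
  two sides met, a path avoiding the barrier would join a low point of the column
  \<open>Re z = s0\<close> to a high one; prolonged vertically, it would have to meet the barrier
  prolonged to the right, by Fashoda.\<close>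

lemma crossing_path:
  fixes p :: "real \<Rightarrow> complex"
  assumes p: "path p" "p 0 = Complex s0 y" "Re (p 1) = s1"
    and pos: "\<And>t. 0 < t \<Longrightarrow> t \<le> 1 \<Longrightarrow> Re (p t) > s0"
    and less: "\<And>t. 0 \<le> t \<Longrightarrow> t < 1 \<Longrightarrow> Re (p t) < s1"
  shows "crossing s0 s1 y (path_image p \<union> (\<lambda>x. Complex x y) ` {..s0})" (is "crossing s0 s1 y ?K")
  unfolding crossing_def
proof (intro conjI allI impI)
  have s01: "s0 < s1" using less[of 0] p by auto
  have contp: "continuous_on {0..1} p" using p by (simp add: path_def)
  have ray: "(\<lambda>x. Complex x y) ` {..s0} = {z. Re z \<le> s0} \<inter> {z. Im z = y}"
    by (auto simp: image_iff complex_eq_iff)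
  show cl: "closed ?K"
    unfolding ray by (intro closed_Un closed_path_image p closed_Int closed_halfspace_Re_le closed_Collect_eq continuous_intros)
  have conray: "connected ((\<lambda>x. Complex x y) ` {..s0})"
    by (intro connected_continuous_image) (auto simp: Complex_eq intro!: continuous_intros)
  have conp: "connected (p ` {0..<1})"
    by (intro connected_continuous_image continuous_on_subset[OF contp]) auto
  have eq: "?K \<inter> {z. Re z < s1} = p ` {0..<1} \<union> (\<lambda>x. Complex x y) ` {..s0}"
  proof (intro set_eqI iffI)
    fix z assume "z \<in> ?K \<inter> {z. Re z < s1}"
    then show "z \<in> p ` {0..<1} \<union> (\<lambda>x. Complex x y) ` {..s0}"
      using p(3) by (auto simp: path_image_def less_le image_iff)
  next
    fix z assume "z \<in> p ` {0..<1} \<union> (\<lambda>x. Complex x y) ` {..s0}"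
    then show "z \<in> ?K \<inter> {z. Re z < s1}"
      using less s01 by (auto simp: path_image_def)
  qed
  have "p 0 \<in> p ` {0..<1} \<inter> (\<lambda>x. Complex x y) ` {..s0}" using p(2) by (intro IntI imageI) auto
  then show "connected (?K \<inter> {z. Re z < s1})"
    unfolding eq by (intro connected_Un conray conp) blast
  obtain Yp where Yp: "\<And>z. z \<in> path_image p \<Longrightarrow> norm z \<le> Yp"
    using bounded_path_image[OF p(1)] by (auto simp: bounded_iff)
  define Y where "Y = max Yp \<bar>y\<bar>"
  have Y: "\<forall>z\<in>?K. \<bar>Im z\<bar> \<le> Y"
  proof
    fix z assume "z \<in> ?K"
    then show "\<bar>Im z\<bar> \<le> Y"
      using Yp[of z] abs_Im_le_cmod[of z] by (auto simp: Y_def)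
  qed
  then show "\<exists>Y. \<forall>z\<in>?K. \<bar>Im z\<bar> \<le> Y" by blast
  show col: "(Complex s0 t \<in> ?K) = (t = y)" for t
  proof
    assume "Complex s0 t \<in> ?K"
    moreover have "t = y" if "Complex s0 t = p u" "u \<in> {0..1}" for u
    proof (cases "u = 0")
      case False
      then have "Re (p u) > s0" using pos that by auto
      then show ?thesis using that by (metis complex.sel(1) less_irrefl)
    qed (use that p in auto)
    ultimately show "t = y" by (auto simp: path_image_def)
  qed auto
  show "\<exists>t. Complex s t \<in> ?K" if "s0 < s" "s < s1" for s
  proof -
    have "\<exists>x\<ge>0. x \<le> 1 \<and> Re (p x) = s"
      using that p by (intro IVT' continuous_intros contp) auto
    then obtain u where u: "u \<in> {0..1}" "Re (p u) = s" by auto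
    then have "Complex s (Im (p u)) \<in> ?K" by (auto simp: path_image_def)
    then show ?thesis by blast
  qed
  show "side 1 s0 s1 ?K \<inter> side (- 1) s0 s1 ?K = {}"
  proof (rule ccontr)
    assume "side 1 s0 s1 ?K \<inter> side (- 1) s0 s1 ?K \<noteq> {}"
    then obtain z where z: "z \<in> side 1 s0 s1 ?K" "z \<in> side (- 1) s0 s1 ?K" by blast
    let ?H = "{z. Re z < s1} - ?K"
    obtain Y1 where Y1: "\<And>Y. Y \<ge> Y1 \<Longrightarrow> connected_component ?H z (Complex s0 Y)"
      using z(1) by (auto simp: side_def)
    obtain Y2 where Y2: "\<And>Y. Y \<ge> Y2 \<Longrightarrow> connected_component ?H z (Complex s0 (- Y))"
      using z(2) by (auto simp: side_def)
    \<comment> \<open>High enough for both reference directions, and beyond \<open>y\<close>, so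
      that the vertical prolongations miss the point where the barrier crosses the column.\<close>
    define W where "W = max (max Y1 Y2) (\<bar>y\<bar> + 1)"
    have "connected_component ?H (Complex s0 (- W)) (Complex s0 W)"
    proof (rule connected_component_trans)
      show "connected_component ?H (Complex s0 (- W)) z"
        by (rule connected_component_sym, rule Y2) (simp add: W_def)
      show "connected_component ?H z (Complex s0 W)" using Y1[of W] by (simp add: W_def)
    qed
    then have "path_component ?H (Complex s0 (- W)) (Complex s0 W)"
      using open_halfplane_diff[OF cl] by (simp add: open_path_connected_component)
    then obtain g where g: "path g" "path_image g \<subseteq> ?H" "pathstart g = Complex s0 (- W)" "pathfinish g = Complex s0 W"
      by (auto simp: path_component_def)
    obtain G where G: "\<And>z. z \<in> path_image g \<Longrightarrow> norm z \<le> G"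
      using bounded_path_image[OF g(1)] by (auto simp: bounded_iff)
    define Z where "Z = max (max Yp G) (max W (\<bar>s0\<bar> + \<bar>s1\<bar> + 1))"
    have Z: "Yp \<le> Z" "G \<le> Z" "W \<le> Z" "\<bar>s0\<bar> + \<bar>s1\<bar> + 1 \<le> Z" by (auto simp: Z_def)
    \<comment> \<open>The added horizontal piece on the right lies in \<open>Re z \<ge> s1\<close>,
      whereas \<open>g\<close> lies in \<open>Re z < s1\<close> and the vertical pieces of
      \<open>k\<close> lie on the column \<open>s0 < s1\<close>. Any meeting point is therefore on
      \<open>?K\<close>.\<close>
    define h where "h = linepath (Complex (- Z) y) (Complex s0 y) +++ p +++ linepath (p 1) (Complex Z (Im (p 1)))"
    define k where "k = linepath (Complex s0 (- Z)) (Complex s0 (- W)) +++ g +++ linepath (Complex s0 W) (Complex s0 Z)"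
    have ends: "pathstart p = Complex s0 y" "pathfinish p = p 1"
      using p by (auto simp: pathstart_def pathfinish_def)
    have p1: "p 1 \<in> path_image p" by (auto simp: path_image_def)
    have hor: "z \<in> closed_segment (Complex a c) (Complex b c) \<longleftrightarrow> Im z = c \<and> a \<le> Re z \<and> Re z \<le> b"
      if "a \<le> b" for a b c z
      using that by (subst closed_segment_same_Im) (auto simp: closed_segment_eq_real_ivl)
    have ver: "z \<in> closed_segment (Complex c a) (Complex c b) \<longleftrightarrow> Re z = c \<and> a \<le> Im z \<and> Im z \<le> b"
      if "a \<le> b" for a b c z
      using that by (subst closed_segment_same_Re) (auto simp: closed_segment_eq_real_ivl)
    have hp: "path h" unfolding h_def using p ends by (intro path_join_imp) auto
    have kp: "path k" unfolding k_def using g by (intro path_join_imp) auto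
    have p1c: "p 1 = Complex s1 (Im (p 1))" using p(3) by (simp add: complex_eq_iff)
    have hi: "z \<in> path_image h \<longleftrightarrow> (Im z = y \<and> - Z \<le> Re z \<and> Re z \<le> s0) \<or> z \<in> path_image p \<or>
        (Im z = Im (p 1) \<and> s1 \<le> Re z \<and> Re z \<le> Z)" for z
      unfolding h_def using ends Z hor[of "- Z" s0 z y] hor[of s1 Z z "Im (p 1)"] p1c
      by (simp add: path_image_join)
    have ki: "z \<in> path_image k \<longleftrightarrow> (Re z = s0 \<and> - Z \<le> Im z \<and> Im z \<le> - W) \<or> z \<in> path_image g \<or>
        (Re z = s0 \<and> W \<le> Im z \<and> Im z \<le> Z)" for z
      unfolding k_def using g Z ver[of "- Z" "- W" z s0] ver[of W Z z s0]
      by (simp add: path_image_join)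
    have bd: "- Z \<le> Re z \<and> Re z \<le> Z \<and> - Z \<le> Im z \<and> Im z \<le> Z" if "norm z \<le> Z" for z
      using that abs_Re_le_cmod[of z] abs_Im_le_cmod[of z] by linarith
    have W0: "W \<ge> \<bar>y\<bar> + 1" by (simp add: W_def)
    obtain w where w: "w \<in> path_image h" "w \<in> path_image k"
    proof (rule fashoda_complex[OF hp kp])
      show "- Z \<le> Re z \<and> Re z \<le> Z \<and> - Z \<le> Im z \<and> Im z \<le> Z" if "z \<in> path_image h" for z
        using that[unfolded hi]
      proof (elim disjE)
        assume "z \<in> path_image p"
        then show ?thesis using Yp[of z] Z by (intro bd) auto
      next
        assume "Im z = Im (p 1) \<and> s1 \<le> Re z \<and> Re z \<le> Z"
        then show ?thesis using bd[of "p 1"] Yp[OF p1] Z by auto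
      qed (use Z W0 in auto)
      show "- Z \<le> Re z \<and> Re z \<le> Z \<and> - Z \<le> Im z \<and> Im z \<le> Z" if "z \<in> path_image k" for z
        using that[unfolded ki]
      proof (elim disjE)
        assume "z \<in> path_image g"
        then show ?thesis using G[of z] Z by (intro bd) auto
      qed (use Z W0 in auto)
    qed (auto simp: h_def k_def)
    from w(2)[unfolded ki] show False
    proof (elim disjE)
      assume "w \<in> path_image g"
      then have "w \<notin> ?K" "Re w < s1" using g by auto
      then show False using w(1)[unfolded hi] ray by auto
    next
      assume *: "Re w = s0 \<and> - Z \<le> Im w \<and> Im w \<le> - W"
      then have "w = Complex s0 (Im w)" by (simp add: complex_eq_iff)
      then have "w \<in> ?K \<Longrightarrow> Im w = y" using col by metis
      then show False using * w(1)[unfolded hi] W0 s01 by auto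
    next
      assume *: "Re w = s0 \<and> W \<le> Im w \<and> Im w \<le> Z"
      then have "w = Complex s0 (Im w)" by (simp add: complex_eq_iff)
      then have "w \<in> ?K \<Longrightarrow> Im w = y" using col by metis
      then show False using * w(1)[unfolded hi] W0 s01 by auto
    qed
  qed
qed

section \<open>The region between two barriers and its vertical sections\<close>

text \<open>A point higher than all of \<open>K'\<close> is above \<open>K'\<close>, and a point
  lower than all of \<open>K\<close> is below \<open>K\<close>; disjointness of sides excludes
  both.\<close>

lemma region_bounded:
  assumes K: "crossing s0 s1 y K" "crossing s0 s1 y' K'" and "s0 < s1"
  obtains L where "\<And>z. z \<in> side 1 s0 s1 K \<inter> side (-1) s0 s1 K' \<Longrightarrow> \<bar>Im z\<bar> \<le> L"
proof -
  obtain Y Y' where Y: "\<forall>z\<in>K. \<bar>Im z\<bar> \<le> Y" "\<forall>z\<in>K'. \<bar>Im z\<bar> \<le> Y'" using K by (auto simp: crossing_def)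
  show ?thesis
  proof (rule that[of "max Y Y'"])
    fix z assume z: "z \<in> side 1 s0 s1 K \<inter> side (-1) s0 s1 K'"
    then have "z \<notin> side (-1) s0 s1 K" "z \<notin> side 1 s0 s1 K'"
      using K by (auto simp: crossing_def)
    then show "\<bar>Im z\<bar> \<le> max Y Y'"
      using side_beyond[OF Y(1), of "-1" s0 s1 z] side_beyond[OF Y(2), of 1 s0 s1 z] z sideD \<open>s0 < s1\<close>
      by (force simp: abs_if)
  qed
qed

text \<open>Take the highest point \<open>x\<close> of \<open>K\<close> on the column and the lowest
  point \<open>q\<close> of \<open>K'\<close> above it. Such a \<open>q\<close> exists:
  \<open>x\<close> lies below \<open>K'\<close>, and without a further meeting the rest of the
  column would stay below \<open>K'\<close>, although its distant points are above.\<close>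

lemma region_column:
  assumes K: "crossing s0 s1 y K" "crossing s0 s1 y' K'" and "y < y'" "K \<inter> K' \<inter> {z. Re z < s1} = {}"
    and s: "s0 < s" "s < s1"
  obtains x q where "x < q" "Complex s x \<in> K" "Complex s q \<in> K'"
    "\<And>t. x < t \<Longrightarrow> t < q \<Longrightarrow> Complex s t \<in> side 1 s0 s1 K \<inter> side (-1) s0 s1 K'"
proof -
  have s01: "s0 < s1" using s by simp
  obtain Y Y' where Y: "\<forall>z\<in>K. \<bar>Im z\<bar> \<le> Y" "\<forall>z\<in>K'. \<bar>Im z\<bar> \<le> Y'" using K by (auto simp: crossing_def)
  have cl: "closed (Complex s -` A)" if "closed A" for A
    using that by (intro closed_vimage) (auto simp: Complex_eq intro!: continuous_intros)
  define X where "X = Complex s -` K"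
  have X: "closed X" "X \<noteq> {}" "bdd_above X"
  proof -
    show "closed X" using K cl by (simp add: X_def crossing_def)
    obtain t where "Complex s t \<in> K" using K(1) s by (auto simp: crossing_def)
    then show "X \<noteq> {}" by (auto simp: X_def)
    show "bdd_above X" using Y(1) by (intro bdd_aboveI[of _ Y]) (force simp: X_def)
  qed
  define x where "x = Sup X"
  have xK: "Complex s x \<in> K" using closed_contains_Sup[OF X(2,3,1)] by (simp add: x_def X_def)
  have up: "Complex s t \<in> side 1 s0 s1 K" if "t > x" for t
  proof (rule side_absorb)
    show "connected (Complex s ` {x<..})" by (intro connected_column) auto
    show "Complex s ` {x<..} \<subseteq> {z. Re z < s1} - K"
      using s cSup_upper[OF _ X(3)] by (force simp: x_def X_def)
    show "Complex s (max (x + 1) (Y + 1)) \<in> side 1 s0 s1 K"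
      using s s01 Y by (intro side_beyond[of K Y]) auto
  qed (use that in auto)
  have low: "Complex s x \<in> side (-1) s0 s1 K'"
    using crossing_subset_side[OF K(2,1) _, of "-1"] xK s assms(3,4) by (auto simp: Int_commute)
  define Q where "Q = {x..} \<inter> Complex s -` K'"
  have "Q \<noteq> {}"
  proof
    assume Q0: "Q = {}"
    have "Complex s (max (x + 1) (Y' + 1)) \<in> side (-1) s0 s1 K'"
    proof (rule side_absorb[OF low])
      show "connected (Complex s ` {x..})" by (intro connected_column) auto
      show "Complex s ` {x..} \<subseteq> {z. Re z < s1} - K'" using Q0 s by (auto simp: Q_def)
    qed auto
    moreover have "Complex s (max (x + 1) (Y' + 1)) \<in> side 1 s0 s1 K'"
      using s s01 Y by (intro side_beyond[of K' Y']) auto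
    ultimately show False using K by (auto simp: crossing_def)
  qed
  moreover have "closed Q" using K cl by (auto simp: Q_def crossing_def)
  moreover have bb: "bdd_below Q" by (auto simp: Q_def)
  ultimately have q: "Inf Q \<in> Q" by (blast intro: closed_contains_Inf)
  show ?thesis
  proof (rule that[of x "Inf Q"])
    have "Inf Q \<noteq> x" using xK q s assms(4) by (auto simp: Q_def)
    then show "x < Inf Q" using q by (auto simp: Q_def)
    show "Complex s x \<in> K" by fact
    show "Complex s (Inf Q) \<in> K'" using q by (auto simp: Q_def)
    fix t assume t: "x < t" "t < Inf Q"
    have "Complex s t \<in> side (-1) s0 s1 K'"
    proof (rule side_absorb[OF low])
      show "connected (Complex s ` {x..t})" by (intro connected_column) auto
      show "Complex s ` {x..t} \<subseteq> {z. Re z < s1} - K'"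
        using cInf_lower[OF _ bb] t s by (force simp: Q_def)
    qed (use t in auto)
    then show "Complex s t \<in> side 1 s0 s1 K \<inter> side (-1) s0 s1 K'" using up t by auto
  qed
qed

text \<open>The path is cut at its last visit to \<open>\<bar>z\<bar> = e\<^bsup>s0\<^esup>\<close> and at the first later visit to \<open>\<bar>z\<bar> = e\<^bsup>s1\<^esup>\<close>.\<close>

lemma log_lift_path:
  fixes \<gamma> :: "real \<Rightarrow> complex"
  assumes cont: "continuous_on {T0..} \<gamma>" and lim: "filterlim \<gamma> at_infinity at_top"
    and T0: "norm (\<gamma> T0) < exp s0" and s01: "s0 < s1"
  obtains p y where "path p" "p 0 = Complex s0 y" "Re (p 1) = s1" "0 \<le> y" "y < 2 * pi"
    "\<And>t. 0 < t \<Longrightarrow> t \<le> 1 \<Longrightarrow> Re (p t) > s0" "\<And>t. 0 \<le> t \<Longrightarrow> t < 1 \<Longrightarrow> Re (p t) < s1"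
    "\<And>t. 0 \<le> t \<Longrightarrow> t \<le> 1 \<Longrightarrow> exp (p t) \<in> \<gamma> ` {T0..}"
proof -
  define N where "N = (\<lambda>t. norm (\<gamma> t))"
  have contN: "continuous_on {a..b} N" if "a \<ge> T0" for a b
    unfolding N_def using that by (intro continuous_intros continuous_on_subset[OF cont]) auto
  have "eventually (\<lambda>t. norm (\<gamma> t) \<ge> exp s1 + 1) at_top"
    using lim unfolding filterlim_at_infinity[OF order_refl] using exp_gt_zero[of s1] by (meson add_pos_pos zero_less_one)
  then obtain T1' where "\<And>t. t \<ge> T1' \<Longrightarrow> N t \<ge> exp s1 + 1" by (auto simp: eventually_at_top_linorder N_def)
  define T1 where "T1 = max T1' (T0 + 1)"
  have T1: "T1 > T0" "N T1 > exp s1"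
    using \<open>\<And>t. t \<ge> T1' \<Longrightarrow> N t \<ge> exp s1 + 1\<close>[of T1] by (auto simp: T1_def)
  have es: "exp s0 < exp s1" using s01 by simp
  have level: "closed {t \<in> {a..b}. N t = r}" if "a \<ge> T0" for a b r
  proof -
    have "{t \<in> {a..b}. N t = r} = {a..b} \<inter> N -` {r}" by auto
    then show ?thesis
      using continuous_closed_preimage[OF contN[OF that, of b] closed_atLeastAtMost closed_singleton[of r]]
      by (simp only:)
  qed
  define A where "A = {t \<in> {T0..T1}. N t = exp s0}"
  have IVT0: "\<exists>x\<in>{a..T1}. N x = r" if "a \<ge> T0" "a \<le> T1" "N a \<le> r" "r \<le> exp s1" for a r
    using IVT'[of N a r T1] contN[OF that(1)] that T1 by fastforce
  have "A \<noteq> {}" using IVT0[of T0 "exp s0"] T0 T1 es by (auto simp: A_def N_def)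
  moreover have "closed A" unfolding A_def by (intro level) simp
  moreover have bA: "bdd_above A" by (auto simp: A_def)
  ultimately have "Sup A \<in> A" by (intro closed_contains_Sup)
  define \<alpha> where "\<alpha> = Sup A"
  have \<alpha>: "T0 \<le> \<alpha>" "\<alpha> \<le> T1" "N \<alpha> = exp s0" using \<open>Sup A \<in> A\<close> by (auto simp: A_def \<alpha>_def)
  have after: "N t > exp s0" if "\<alpha> < t" "t \<le> T1" for t
  proof (rule ccontr)
    assume "\<not> N t > exp s0"
    then have "\<exists>x\<in>{t..T1}. N x = exp s0"
      using that \<alpha>(1) es by (intro IVT0) linarith+
    then obtain x where "x \<in> {t..T1}" "N x = exp s0" by blast
    then have "x \<in> A" "x > \<alpha>" using that \<alpha> by (auto simp: A_def)
    then show False using cSup_upper[OF _ bA] by (force simp: \<alpha>_def)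
  qed
  define C where "C = {t \<in> {\<alpha>..T1}. N t = exp s1}"
  have "C \<noteq> {}" using IVT0[of \<alpha> "exp s1"] \<alpha> es by (auto simp: C_def)
  moreover have "closed C" unfolding C_def by (intro level \<alpha>)
  moreover have bC: "bdd_below C" by (auto simp: C_def)
  ultimately have "Inf C \<in> C" by (intro closed_contains_Inf)
  define \<beta> where "\<beta> = Inf C"
  have \<beta>: "\<alpha> \<le> \<beta>" "\<beta> \<le> T1" "N \<beta> = exp s1" using \<open>Inf C \<in> C\<close> by (auto simp: C_def \<beta>_def)
  have "\<alpha> < \<beta>" using \<alpha> \<beta> es by (cases "\<alpha> = \<beta>") auto
  have before: "N t < exp s1" if "\<alpha> \<le> t" "t < \<beta>" for t
  proof (rule ccontr)
    assume "\<not> N t < exp s1"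
    then have "\<exists>x\<ge>\<alpha>. x \<le> t \<and> N x = exp s1"
      using that \<alpha> es by (intro IVT' contN) linarith+
    then obtain x where "x \<ge> \<alpha>" "x \<le> t" "N x = exp s1" by blast
    then have "x \<in> C" "x < \<beta>" using that \<beta> by (auto simp: C_def)
    then show False using cInf_lower[OF _ bC] by (force simp: \<beta>_def)
  qed
  define r where "r = (\<lambda>u. \<alpha> + (\<beta> - \<alpha>) * u)"
  have r: "r u \<ge> \<alpha>" "r u \<le> \<beta>" if "0 \<le> u" "u \<le> 1" for u
  proof -
    have "0 \<le> (\<beta> - \<alpha>) * u" using that \<open>\<alpha> < \<beta>\<close> by simp
    then show "r u \<ge> \<alpha>" unfolding r_def by linarith
    have "(\<beta> - \<alpha>) * u \<le> (\<beta> - \<alpha>) * 1" using that \<open>\<alpha> < \<beta>\<close> by (intro mult_left_mono) auto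
    then show "r u \<le> \<beta>" unfolding r_def by (simp add: algebra_simps)
  qed
  have contq: "continuous_on {0..1} (\<lambda>u. \<gamma> (r u))"
    by (rule continuous_on_compose2[OF cont]) (use r \<alpha> in \<open>force simp: r_def intro!: continuous_intros\<close>)+
  have Npos: "N (r u) \<ge> exp s0" if "0 \<le> u" "u \<le> 1" for u
    using after[of "r u"] r[OF that] \<alpha> \<beta> by (cases "r u = \<alpha>") auto
  have q0: "\<gamma> (r u) \<noteq> 0" if "u \<in> {0..1}" for u
    using Npos[of u] that exp_gt_zero[of s0] by (force simp: N_def)
  obtain g where g: "continuous_on {0..1} g" "\<And>u. u \<in> {0..1} \<Longrightarrow> \<gamma> (r u) = exp (g u)"
    using continuous_logarithm_on_contractible[OF contq convex_imp_contractible q0] by auto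
  have Re_g: "N (r u) = exp (Re (g u))" if "u \<in> {0..1}" for u
    using g(2)[OF that] by (simp add: N_def)
  \<comment> \<open>Subtracting this multiple of the period moves the starting height into the
    interval from 0 to \<open>2 * pi\<close>; the ordering of the lifts modulo the period relies on
    it.\<close>
  define k where "k = \<lfloor>Im (g 0) / (2 * pi)\<rfloor>"
  define p where "p = (\<lambda>u. g u - 2 * of_int k * pi * \<i>)"
  define y where "y = Im (g 0) - 2 * of_int k * pi"
  have Re_p: "Re (p u) = Re (g u)" for u by (simp add: p_def)
  show ?thesis
  proof (rule that[of p y])
    show "path p" unfolding path_def p_def by (intro continuous_intros g)
    have "Re (g 0) = s0" using Re_g[of 0] \<alpha> by (simp add: r_def)
    then show "p 0 = Complex s0 y" by (simp add: p_def y_def complex_eq_iff)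
    show "Re (p 1) = s1" using Re_g[of 1] \<beta> by (simp add: r_def Re_p)
    have "of_int k \<le> Im (g 0) / (2 * pi)" "Im (g 0) / (2 * pi) < of_int k + 1"
      unfolding k_def by linarith+
    then show "0 \<le> y" "y < 2 * pi" by (auto simp: y_def field_simps)
    fix t :: real
    show "Re (p t) > s0" if "0 < t" "t \<le> 1"
    proof -
      have "r t > \<alpha>" using that \<open>\<alpha> < \<beta>\<close> by (simp add: r_def)
      then have "N (r t) > exp s0" using after r[of t] that \<beta> by auto
      then show ?thesis using Re_g[of t] that by (simp add: Re_p)
    qed
    show "Re (p t) < s1" if "0 \<le> t" "t < 1"
    proof -
      have "(\<beta> - \<alpha>) * t < (\<beta> - \<alpha>) * 1" using that \<open>\<alpha> < \<beta>\<close> by (intro mult_strict_left_mono) auto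
      then have "r t < \<beta>" by (simp add: r_def algebra_simps)
      then have "N (r t) < exp s1" using before r[of t] that by auto
      then show ?thesis using Re_g[of t] that by (simp add: Re_p)
    qed
    show "exp (p t) \<in> \<gamma> ` {T0..}" if "0 \<le> t" "t \<le> 1"
    proof -
      have "exp (p t) = exp (g t)"
        unfolding p_def exp_diff using exp_2pi_1_int[of k] by (simp add: mult_ac)
      then have "exp (p t) = \<gamma> (r t)" using g that by simp
      then show ?thesis using r[of t] that \<alpha> by auto
    qed
  qed
qed

text \<open>The \<open>n\<close> lifts are sorted by starting height and then repeated with period
  \<open>2 * pi\<close> in the imaginary direction, so \<open>m\<close> stands for the lift of rank
  \<open>m mod n\<close> shifted by \<open>m div n\<close> periods. Since \<open>n \<ge> 2\<close>,
  neighbours belong to different values. They are disjoint to the right of \<open>s0\<close> because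
  their images under \<open>exp\<close> are, and to the left because they are rays at different
  heights.\<close>

lemma crossing_family:
  fixes \<gamma> :: "nat \<Rightarrow> real \<Rightarrow> complex" and V :: "nat \<Rightarrow> complex set"
  assumes n: "n \<ge> 2" and s01: "s0 < s1"
    and cont: "\<And>i. i < n \<Longrightarrow> continuous_on {T i..} (\<gamma> i)"
    and lim: "\<And>i. i < n \<Longrightarrow> filterlim (\<gamma> i) at_infinity at_top"
    and start: "\<And>i. i < n \<Longrightarrow> norm (\<gamma> i (T i)) < exp s0"
    and V: "\<And>i. i < n \<Longrightarrow> \<gamma> i ` {T i..} \<subseteq> V i"
    and disj: "\<And>i j. i < n \<Longrightarrow> j < n \<Longrightarrow> i \<noteq> j \<Longrightarrow> V i \<inter> V j = {}"
  obtains K :: "nat \<Rightarrow> complex set" and y :: "nat \<Rightarrow> real" and \<sigma> :: "nat \<Rightarrow> nat"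
  where "\<And>m. crossing s0 s1 (y m) (K m)" "strict_mono y"
    "\<And>m. \<sigma> m < n" "\<And>m. \<sigma> m \<noteq> \<sigma> (Suc m)"
    "\<And>m z. z \<in> K m \<Longrightarrow> s0 \<le> Re z \<Longrightarrow> exp z \<in> V (\<sigma> m)"
    "\<And>m. K m \<inter> K (Suc m) = {}"
    "\<And>m. K (m + n) = (+) (Complex 0 (2 * pi)) ` K m"
proof -
  define good where "good = (\<lambda>i p y. path p \<and> p 0 = Complex s0 y \<and> Re (p 1) = s1 \<and> 0 \<le> y \<and> y < 2 * pi \<and>
    (\<forall>t. 0 < t \<longrightarrow> t \<le> 1 \<longrightarrow> Re (p t) > s0) \<and> (\<forall>t. 0 \<le> t \<longrightarrow> t < 1 \<longrightarrow> Re (p t) < s1) \<and>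
    (\<forall>t. 0 \<le> t \<longrightarrow> t \<le> 1 \<longrightarrow> exp (p t) \<in> V i))"
  have "\<exists>p y. good i p y" if "i < n" for i
    using log_lift_path[OF cont[OF that] lim[OF that] start[OF that] s01] V[OF that]
    unfolding good_def by (smt (verit) subsetD)
  then obtain p y0 where good: "\<And>i. i < n \<Longrightarrow> good i (p i) (y0 i)" by metis
  define K0 where "K0 = (\<lambda>i. path_image (p i) \<union> (\<lambda>x. Complex x (y0 i)) ` {..s0})"
  have cr0: "crossing s0 s1 (y0 i) (K0 i)" if "i < n" for i
    unfolding K0_def using good[OF that] by (intro crossing_path) (auto simp: good_def)
  have expK0: "exp z \<in> V i" if "i < n" "z \<in> K0 i" "s0 \<le> Re z" for i z
  proof -
    have "z \<in> path_image (p i)"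
    proof (rule ccontr)
      assume "z \<notin> path_image (p i)"
      then have "z = Complex s0 (y0 i)" using that(2,3) by (auto simp: K0_def)
      moreover have "p i 0 = Complex s0 (y0 i)" using good[OF that(1)] by (simp add: good_def)
      moreover have "p i 0 \<in> path_image (p i)" by (simp add: path_image_def)
      ultimately show False using \<open>z \<notin> path_image (p i)\<close> by simp
    qed
    then show ?thesis using good[OF that(1)] unfolding good_def by (auto simp: path_image_def)
  qed
  have leftK0: "Im z = y0 i" if "i < n" "z \<in> K0 i" "Re z < s0" for i z
  proof -
    have "Re (p i u) \<ge> s0" if "u \<in> {0..1}" for u
      using good[OF \<open>i < n\<close>] that unfolding good_def by (cases "u = 0") (force simp: less_imp_le)+
    then show ?thesis using that unfolding K0_def by (auto simp: path_image_def not_less[symmetric])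
  qed
  \<comment> \<open>Two lifts with the same starting height would share their starting point, whose
    image under \<open>exp\<close> would lie in two disjoint sets.\<close>
  have inj: "inj_on y0 {..<n}"
  proof (rule inj_onI)
    fix i j assume ij: "i \<in> {..<n}" "j \<in> {..<n}" "y0 i = y0 j"
    then have "exp (Complex s0 (y0 i)) \<in> V i" "exp (Complex s0 (y0 i)) \<in> V j"
      using good[of i] good[of j] unfolding good_def by (auto dest: spec[of _ 0])
    then show "i = j" using disj[of i j] ij by auto
  qed
  define xs where "xs = sorted_list_of_set (y0 ` {..<n})"
  have len: "length xs = n" and xs_set: "set xs = y0 ` {..<n}"
    using inj by (auto simp: xs_def card_image)
  have "sorted_wrt (<) xs" by (simp add: xs_def strict_sorted_list_of_set)
  then have xs_less: "xs ! k < xs ! k'" if "k < k'" "k' < n" for k k'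
    using that len by (simp add: sorted_wrt_iff_nth_less)
  define \<tau> where "\<tau> = (\<lambda>k. inv_into {..<n} y0 (xs ! k))"
  have \<tau>: "\<tau> k < n" "y0 (\<tau> k) = xs ! k" if "k < n" for k
  proof -
    have "xs ! k \<in> y0 ` {..<n}" using xs_set len that nth_mem by blast
    then show "\<tau> k < n" "y0 (\<tau> k) = xs ! k"
      using inv_into_into[of "xs ! k" y0 "{..<n}"] by (auto simp: \<tau>_def f_inv_into_f)
  qed
  have xs_range: "0 \<le> xs ! k" "xs ! k < 2 * pi" if "k < n" for k
    using good[OF \<tau>(1)[OF that]] \<tau>(2)[OF that] unfolding good_def by auto
  define c where "c = (\<lambda>m. Complex 0 (2 * pi * real (m div n)))"
  define \<sigma> where "\<sigma> = (\<lambda>m. \<tau> (m mod n))"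
  define K where "K = (\<lambda>m. (+) (c m) ` K0 (\<sigma> m))"
  define y where "y = (\<lambda>m. xs ! (m mod n) + 2 * pi * real (m div n))"
  have n0: "m mod n < n" for m using n by simp
  have \<sigma>n: "\<sigma> m < n" for m using \<tau> n0 by (simp add: \<sigma>_def)
  have ysm: "strict_mono y"
  proof (rule iffD2[OF strict_mono_Suc_iff], rule allI)
    fix m
    show "y m < y (Suc m)"
    proof (cases "Suc (m mod n) = n")
      \<comment> \<open>Wrap-around: the last height of one period is below \<open>2 * pi\<close>
        and the first height of the next is at least \<open>2 * pi\<close>, relative to the same
        shift.\<close>
      case True
      then have "y (Suc m) = xs ! 0 + 2 * pi * (real (m div n) + 1)"
        by (simp add: y_def mod_Suc div_Suc)
      moreover have "xs ! (m mod n) < 2 * pi" "0 \<le> xs ! 0" using xs_range n0 n by auto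
      ultimately show ?thesis by (simp add: y_def algebra_simps)
    next
      case False
      then have "y (Suc m) = xs ! (Suc (m mod n)) + 2 * pi * real (m div n)"
        by (simp add: y_def mod_Suc div_Suc)
      moreover have "xs ! (m mod n) < xs ! (Suc (m mod n))"
        using False n0[of m] by (intro xs_less) auto
      ultimately show ?thesis by (simp add: y_def)
    qed
  qed
  have \<sigma>Suc: "\<sigma> m \<noteq> \<sigma> (Suc m)" for m
  proof
    assume "\<sigma> m = \<sigma> (Suc m)"
    then have eq: "xs ! (m mod n) = xs ! (Suc m mod n)" using \<tau>(2) n0 by (metis \<sigma>_def)
    have "m mod n \<noteq> Suc m mod n" using n by (auto simp: mod_Suc)
    then show False using eq xs_less n0 by (metis less_irrefl linorder_neqE_nat)
  qed
  have crK: "crossing s0 s1 (y m) (K m)" for m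
  proof -
    have "y m = y0 (\<sigma> m) + Im (c m)" using \<tau>(2)[OF n0] by (simp add: y_def c_def \<sigma>_def)
    then show ?thesis
      unfolding K_def using crossing_translation[OF cr0[OF \<sigma>n], of "c m" m] by (simp add: c_def)
  qed
  have expK: "exp z \<in> V (\<sigma> m)" if "z \<in> K m" "s0 \<le> Re z" for m z
  proof -
    obtain k where k: "k \<in> K0 (\<sigma> m)" "z = c m + k" using \<open>z \<in> K m\<close> by (auto simp: K_def)
    have "c m = \<i> * (of_int (int (m div n)) * (of_real pi * 2))"
      by (simp add: c_def complex_eq_iff)
    then have "exp z = exp k" using k(2) exp_plus_2pin[of k "int (m div n)"] by (simp add: add.commute)
    moreover have "s0 \<le> Re k" using k that(2) by (simp add: c_def)
    ultimately show ?thesis using expK0[OF \<sigma>n k(1)] by simp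
  qed
  have leftK: "Im z = y m" if "z \<in> K m" "Re z < s0" for m z
  proof -
    obtain k where k: "k \<in> K0 (\<sigma> m)" "z = c m + k" using \<open>z \<in> K m\<close> by (auto simp: K_def)
    then have "Im k = y0 (\<sigma> m)" using that by (intro leftK0 \<sigma>n) (auto simp: c_def)
    then show ?thesis using k \<tau>(2)[OF n0] by (simp add: y_def c_def \<sigma>_def)
  qed
  show ?thesis
  proof (rule that[of y K \<sigma>])
    show "K m \<inter> K (Suc m) = {}" for m
    proof (rule ccontr)
      assume "K m \<inter> K (Suc m) \<noteq> {}"
      then obtain z where z: "z \<in> K m" "z \<in> K (Suc m)" by blast
      show False
      proof (cases "Re z < s0")
        case True
        then have "y m = y (Suc m)" using leftK z by metis
        then show False using strict_monoD[OF ysm, of m "Suc m"] by simp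
      next
        case False
        then have "exp z \<in> V (\<sigma> m) \<inter> V (\<sigma> (Suc m))" using expK z by simp
        then show False using disj[OF \<sigma>n \<sigma>n \<sigma>Suc] by blast
      qed
    qed
    show "K (m + n) = (+) (Complex 0 (2 * pi)) ` K m" for m
    proof -
      have "c (m + n) = Complex 0 (2 * pi) + c m" using n by (simp add: c_def complex_eq_iff algebra_simps)
      moreover have "\<sigma> (m + n) = \<sigma> m" by (simp add: \<sigma>_def)
      ultimately show ?thesis by (simp add: K_def image_image add.assoc)
    qed
  qed (fact crK ysm \<sigma>n \<sigma>Suc expK)+
qed

text \<open>The regions and their translates by multiples of \<open>2 \<pi> \<i>\<close> are disjoint, so on a vertical line they
  pack with density at most one.\<close>

lemma region_sections:
  fixes K :: "nat \<Rightarrow> complex set"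
  assumes s01: "s0 < s1" and cr: "\<And>m. crossing s0 s1 (y m) (K m)" and ysm: "strict_mono y"
    and dj: "\<And>m. K m \<inter> K (Suc m) = {}"
    and per: "\<And>m. K (m + n) = (+) (Complex 0 (2 * pi)) ` K m"
  defines "D \<equiv> \<lambda>m. side 1 s0 s1 (K m) \<inter> side (-1) s0 s1 (K (Suc m))"
  shows "(\<Sum>j<n. measure lebesgue {t. Complex s t \<in> D j}) \<le> 2 * pi"
proof -
  have sub: "side 1 s0 s1 (K (Suc m)) \<subseteq> side 1 s0 s1 (K m)" for m
  proof (rule side_mono[OF cr])
    show "K m \<inter> {z. Re z < s1} \<subseteq> side (- 1) s0 s1 (K (Suc m))"
      using dj[of m] strict_monoD[OF ysm, of m "Suc m"] s01
      by (intro crossing_subset_side[OF cr cr]) auto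
  qed simp
  have anti: "side 1 s0 s1 (K m') \<subseteq> side 1 s0 s1 (K m)" if "m \<le> m'" for m m'
    using lift_Suc_antimono_le[of "\<lambda>m. side 1 s0 s1 (K m)", OF sub that] .
  \<comment> \<open>A later region is above \<open>K (Suc m)\<close> because the upper sides
    decrease, while \<open>D m\<close> is below that barrier.\<close>
  have disjD: "D m \<inter> D m' = {}" if "m < m'" for m m'
    using anti[of "Suc m" m'] that side_disjoint[OF cr, of 1 "Suc m"] by (auto simp: D_def)
  define A where "A = (\<lambda>m. {t. Complex s t \<in> D m})"
  have disjA: "disjnt (A m) (A m')" if "m \<noteq> m'" for m m'
    using disjD[of m m'] disjD[of m' m] that by (cases m m' rule: linorder_cases) (auto simp: A_def disjnt_def)
  have openA: "open (A m)" for m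
  proof -
    have "open (D m)" unfolding D_def using cr by (intro open_Int side_open) (auto simp: crossing_def)
    then have "open (Complex s -` D m)"
      by (intro open_vimage) (auto simp: Complex_eq intro!: continuous_intros)
    then show ?thesis by (simp add: A_def vimage_def)
  qed
  have Dper: "D (m + n) = (+) (Complex 0 (2 * pi)) ` D m" for m
    unfolding D_def using per[of m] per[of "Suc m"]
    by (simp add: side_translation image_Int)
  have Aper: "A (m + n) = (+) (2 * pi) ` A m" for m
  proof (intro set_eqI iffI)
    fix t assume "t \<in> A (m + n)"
    then obtain z where z: "z \<in> D m" "Complex s t = Complex 0 (2 * pi) + z" by (auto simp: A_def Dper)
    then have "z = Complex s (t - 2 * pi)" by (auto simp: complex_eq_iff)
    then have "t - 2 * pi \<in> A m" using z by (simp add: A_def)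
    then show "t \<in> (+) (2 * pi) ` A m" by (intro image_eqI[of _ _ "t - 2 * pi"]) auto
  next
    fix t assume "t \<in> (+) (2 * pi) ` A m"
    then obtain u where u: "Complex s u \<in> D m" "t = 2 * pi + u" by (auto simp: A_def)
    moreover have "Complex s t = Complex 0 (2 * pi) + Complex s u" using u by (simp add: complex_eq_iff)
    ultimately show "t \<in> A (m + n)" by (auto simp: A_def Dper)
  qed
  have "\<exists>L. \<forall>z\<in>D m. \<bar>Im z\<bar> \<le> L" for m
    unfolding D_def using region_bounded[OF cr cr s01, of m "Suc m"] by metis
  then obtain L where L: "\<And>m z. z \<in> D m \<Longrightarrow> \<bar>Im z\<bar> \<le> L m" by metis
  define M where "M = (\<Sum>j<n. \<bar>L j\<bar>)"
  have AM: "A j \<subseteq> {- M..M}" if "j < n" for j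
  proof
    fix t assume "t \<in> A j"
    then have "\<bar>t\<bar> \<le> L j" using L[of "Complex s t" j] by (simp add: A_def)
    also have "L j \<le> \<bar>L j\<bar>" by simp
    also have "\<dots> \<le> M" unfolding M_def using that by (intro member_le_sum) auto
    finally show "t \<in> {- M..M}" by auto
  qed
  have Aq: "A (q * n + j) = (+) (2 * pi * real q) ` A j" for q j
  proof (induction q)
    case (Suc q)
    have "A (Suc q * n + j) = A ((q * n + j) + n)" by (simp add: algebra_simps)
    then show ?case unfolding Aper Suc by (simp add: image_image algebra_simps)
  qed simp
  define S where "S = (\<Sum>j<n. measure lebesgue (A j))"
  \<comment> \<open>\<open>N\<close> periods contain \<open>N * n\<close> disjoint sections of total
    length \<open>N * S\<close>, all inside an interval that exceeds \<open>2 * pi * N\<close> only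
    by the fixed length \<open>2 * M\<close>. Taking \<open>N\<close> large removes the
    excess.\<close>
  have packing: "real N * S \<le> 2 * M + 2 * pi * real N" for N
  proof -
    have sub: "A m \<subseteq> {- M..M + 2 * pi * real N}" if "m < N * n" for m
    proof -
      have n: "n > 0" using that by (cases n) auto
      have q: "m div n < N" using that by (simp add: less_mult_imp_div_less)
      have "A m = (+) (2 * pi * real (m div n)) ` A (m mod n)"
        using Aq[of "m div n" "m mod n"] by simp
      also have "\<dots> \<subseteq> {- M..M + 2 * pi * real N}"
      proof safe
        fix t assume "t \<in> A (m mod n)"
        then have "- M \<le> t" "t \<le> M" using AM[of "m mod n"] n by auto
        moreover have "0 \<le> 2 * pi * real (m div n)" "2 * pi * real (m div n) \<le> 2 * pi * real N"
          using q by auto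
        ultimately have "- M \<le> 2 * pi * real (m div n) + t \<and> 2 * pi * real (m div n) + t \<le> M + 2 * pi * real N"
          by linarith
        then show "2 * pi * real (m div n) + t \<in> {- M..M + 2 * pi * real N}" by simp
      qed
      finally show ?thesis .
    qed
    have lm: "A m \<in> lmeasurable" if "m < N * n" for m
      using openA[of m] bounded_subset[OF bounded_closed_interval sub[OF that]]
      by (intro bounded_set_imp_lmeasurable) auto
    have "real N * S = (\<Sum>q<N. \<Sum>j<n. measure lebesgue (A (q * n + j)))"
      by (simp add: Aq measure_translation S_def)
    also have "\<dots> = (\<Sum>q<N. sum (\<lambda>m. measure lebesgue (A m)) {q * n..<q * n + n})"
    proof (rule sum.cong[OF refl])
      fix q
      show "(\<Sum>j<n. measure lebesgue (A (q * n + j))) = (\<Sum>m\<in>{q * n..<q * n + n}. measure lebesgue (A m))"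
        using sum.shift_bounds_nat_ivl[of "\<lambda>m. measure lebesgue (A m)" 0 "q * n" n]
        by (simp add: atLeast0LessThan add.commute)
    qed
    also have "\<dots> = (\<Sum>m<N * n. measure lebesgue (A m))" by (rule sum.nat_group)
    also have "\<dots> = measure lebesgue (\<Union>m<N * n. A m)"
      using lm disjA by (intro measure_UNION'[symmetric]) (auto simp: pairwise_def)
    also have "\<dots> \<le> measure lebesgue {- M..M + 2 * pi * real N}"
      using sub lm by (intro measure_mono_fmeasurable) (auto intro!: fmeasurableD)
    also have "\<dots> \<le> 2 * M + 2 * pi * real N"
    proof -
      have "M \<ge> 0" unfolding M_def by (intro sum_nonneg) auto
      then show ?thesis by simp
    qed
    finally show ?thesis .
  qed
  show ?thesis
  proof (rule ccontr)
    assume "\<not> ?thesis"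
    then have "S - 2 * pi > 0" by (simp add: S_def A_def)
    then obtain N :: nat where "2 * M < real N * (S - 2 * pi)"
      using reals_Archimedean3 by blast
    then show False using packing[of N] by (simp add: algebra_simps)
  qed
qed

section \<open>Growth\<close>

text \<open>The logarithmic derivative of the product of the \<open>B j\<close> is at least \<open>\<Sum>j. 2 \<pi> / l j\<close>, which is at least
  \<open>n\<^sup>2\<close> by the inequality between the arithmetic and the harmonic mean.\<close>

lemma product_growth:
  fixes B B' m l :: "nat \<Rightarrow> real \<Rightarrow> real"
  assumes dm: "\<And>j t. j < n \<Longrightarrow> s0 < t \<Longrightarrow> t < s1 \<Longrightarrow> (m j has_real_derivative 2 * B j t) (at t)"
    and dB: "\<And>j t. j < n \<Longrightarrow> s0 < t \<Longrightarrow> t < s1 \<Longrightarrow> (B j has_real_derivative B' j t) (at t)"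
    and c: "c > 0" "\<And>j t. j < n \<Longrightarrow> s0 < t \<Longrightarrow> t < s1 \<Longrightarrow> B' j t \<ge> c"
    and l: "\<And>j t. j < n \<Longrightarrow> s0 < t \<Longrightarrow> t < s1 \<Longrightarrow> l j t > 0"
    and Bl: "\<And>j t. j < n \<Longrightarrow> s0 < t \<Longrightarrow> t < s1 \<Longrightarrow> B' j t \<ge> 2 * (pi / l j t) * B j t"
    and suml: "\<And>t. s0 < t \<Longrightarrow> t < s1 \<Longrightarrow> (\<Sum>j<n. l j t) \<le> 2 * pi"
    and m0: "\<And>j t. j < n \<Longrightarrow> s0 < t \<Longrightarrow> t < s1 \<Longrightarrow> m j t \<ge> 0"
    and sa: "s0 < sa" and K0: "\<And>j. j < n \<Longrightarrow> B j sa \<ge> - K0" "K0 \<ge> 0"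
    and sb: "sb = sa + (K0 + 1) / c" and s: "sb \<le> s" "s + 1 < s1"
  shows "exp (real n ^ 2 * (s - sb)) \<le> (\<Prod>j<n. m j (s + 1) / 2)"
proof -
  have sab: "sa < sb" using c K0 by (simp add: sb)
  have Bmono: "B j u + c * (t - u) \<le> B j t" if "j < n" "s0 < u" "u \<le> t" "t < s1" for j u t
  proof (cases "u = t")
    case False
    then have "\<exists>z>u. z < t \<and> B j t - B j u = (t - u) * B' j z"
      using that by (intro MVT2) (auto intro: dB)
    then obtain z where z: "u < z" "z < t" "B j t - B j u = (t - u) * B' j z" by blast
    have "(t - u) * c \<le> (t - u) * B' j z"
      using z that by (intro mult_left_mono c(2)) auto
    then show ?thesis using z(3) mult.commute[of c "t - u"] by linarith
  qed simp
  \<comment> \<open>The waiting time \<open>(K0 + 1) / c\<close> lets growth at rate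
    \<open>c\<close> lift \<open>B\<close> from \<open>- K0\<close> to 1. From then on its logarithm
    is nonnegative.\<close>
  have B1: "B j t \<ge> 1" if "j < n" "sb \<le> t" "t < s1" for j t
  proof -
    have "c * (t - sa) \<ge> c * ((K0 + 1) / c)" using that c by (intro mult_left_mono) (auto simp: sb)
    then have "c * (t - sa) \<ge> K0 + 1" using c by simp
    then show ?thesis using Bmono[of j sa t] that sa sab K0(1)[of j] by linarith
  qed
  have sum_inv: "(\<Sum>j<n. 2 * (pi / l j t)) \<ge> real n ^ 2" if "s0 < t" "t < s1" for t
  proof -
    \<comment> \<open>The reciprocal of the average length \<open>2 * pi / n\<close>. The bound
      \<open>2 * k - k\<^sup>2 * l \<le> 1 / l\<close> is the tangent line of the convex function
      \<open>1 / l\<close> at that length.\<close>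
    define k where "k = real n / (2 * pi)"
    have "(\<Sum>j<n. 2 * k - k\<^sup>2 * l j t) \<le> (\<Sum>j<n. 1 / l j t)"
    proof (rule sum_mono)
      fix j assume "j \<in> {..<n}"
      then have lp: "l j t > 0" using l that by auto
      have "0 \<le> (k * l j t - 1)\<^sup>2" by simp
      then have "(2 * k - k\<^sup>2 * l j t) * l j t \<le> 1" by (simp add: power2_eq_square algebra_simps)
      then show "2 * k - k\<^sup>2 * l j t \<le> 1 / l j t" using lp by (simp add: pos_le_divide_eq)
    qed
    moreover have "(\<Sum>j<n. 2 * k - k\<^sup>2 * l j t) = n * (2 * k) - k\<^sup>2 * (\<Sum>j<n. l j t)"
      by (simp add: sum_subtractf sum_distrib_left)
    moreover have "k\<^sup>2 * (\<Sum>j<n. l j t) \<le> k\<^sup>2 * (2 * pi)"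
      using suml[OF that] by (intro mult_left_mono) auto
    ultimately have "(\<Sum>j<n. 1 / l j t) \<ge> n * (2 * k) - k\<^sup>2 * (2 * pi)" by linarith
    also have "n * (2 * k) - k\<^sup>2 * (2 * pi) = real n ^ 2 / (2 * pi)"
      by (simp add: k_def power2_eq_square field_simps)
    finally have "2 * pi * (real n ^ 2 / (2 * pi)) \<le> 2 * pi * (\<Sum>j<n. 1 / l j t)"
      by (intro mult_left_mono) auto
    then show ?thesis by (simp add: sum_distrib_left)
  qed
  define W where "W = (\<lambda>t. (\<Sum>j<n. ln (B j t)) - real n ^ 2 * t)"
  have "W sb \<le> W s"
  proof (rule DERIV_nonneg_imp_nondecreasing[OF s(1)])
    fix t assume t: "sb \<le> t" "t \<le> s"
    then have t': "s0 < t" "t < s1" using sa sab s by auto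
    have "((\<lambda>t. ln (B j t)) has_real_derivative B' j t / B j t) (at t)" if "j < n" for j
    proof -
      have "B j t > 0" using B1[OF that] t t' by force
      then show ?thesis using DERIV_chain2[OF DERIV_ln dB[OF that t']] by (simp add: field_simps)
    qed
    then have "(W has_real_derivative (\<Sum>j<n. B' j t / B j t) - real n ^ 2) (at t)"
      unfolding W_def by (intro DERIV_diff DERIV_sum DERIV_cmult_Id) auto
    moreover have "(\<Sum>j<n. B' j t / B j t) - real n ^ 2 \<ge> 0"
    proof -
      have "(\<Sum>j<n. 2 * (pi / l j t)) \<le> (\<Sum>j<n. B' j t / B j t)"
      proof (rule sum_mono)
        fix j assume j: "j \<in> {..<n}"
        then have "B j t > 0" using B1[of j t] t t' by force
        then show "2 * (pi / l j t) \<le> B' j t / B j t"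
          using Bl[of j t] j t' by (simp add: pos_le_divide_eq)
      qed
      then show ?thesis using sum_inv[OF t'] by linarith
    qed
    ultimately show "\<exists>y. (W has_real_derivative y) (at t) \<and> 0 \<le> y" by blast
  qed
  moreover have "(\<Sum>j<n. ln (B j sb)) \<ge> 0"
    using B1 s by (intro sum_nonneg) auto
  ultimately have "real n ^ 2 * (s - sb) \<le> (\<Sum>j<n. ln (B j s))"
    by (simp add: W_def algebra_simps)
  then have "exp (real n ^ 2 * (s - sb)) \<le> exp (\<Sum>j<n. ln (B j s))" by simp
  also have "\<dots> = (\<Prod>j<n. B j s)"
    unfolding exp_sum[OF finite_lessThan]
  proof (rule prod.cong[OF refl])
    fix j assume "j \<in> {..<n}"
    then have "B j s > 0" using B1[of j s] s by force
    then show "exp (ln (B j s)) = B j s" by simp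
  qed
  also have "\<dots> \<le> (\<Prod>j<n. m j (s + 1) / 2)"
  proof (rule prod_mono)
    fix j assume "j \<in> {..<n}"
    then have j: "j < n" by simp
    have s': "s0 < s" using sa sab s by linarith
    \<comment> \<open>Comparing \<open>B\<close> with its primitive over a unit step:
      \<open>B\<close> increases and \<open>m j s\<close> is nonnegative, so \<open>B j s\<close> is
      at most half of \<open>m j (s + 1)\<close>.\<close>
    have "\<exists>z>s. z < s + 1 \<and> m j (s + 1) - m j s = (s + 1 - s) * (2 * B j z)"
      using s s' j by (intro MVT2) (auto intro!: dm)
    then obtain z where z: "s < z" "z < s + 1" "m j (s + 1) - m j s = 2 * B j z" by auto
    have "B j s + c * (z - s) \<le> B j z" using Bmono[OF j s', of z] z s by auto
    moreover have "c * (z - s) \<ge> 0" using c z by simp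
    ultimately have "B j s \<le> B j z" by linarith
    moreover have "m j s \<ge> 0" using m0[OF j s'] s by auto
    ultimately show "0 \<le> B j s \<and> B j s \<le> m j (s + 1) / 2" using B1[OF j s(1)] s z by auto
  qed
  finally show ?thesis .
qed

section \<open>Growth of the entire function and of the potentials\<close>

lemma norm_le_max_modulus:
  assumes "f holomorphic_on UNIV"
  shows "cmod (f z) \<le> max_modulus f (cmod z)"
  unfolding max_modulus_def
proof (rule cSup_upper)
  have "compact ((\<lambda>z. cmod (f z)) ` sphere 0 (cmod z))"
    using holomorphic_on_imp_continuous_on[OF assms]
    by (intro compact_continuous_image compact_sphere continuous_intros) (auto intro: continuous_on_subset)
  then show "bdd_above ((\<lambda>z. cmod (f z)) ` sphere 0 (cmod z))"
    by (intro bounded_imp_bdd_above compact_imp_bounded)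
qed auto

lemma le_exp_powr_of_logplus:
  assumes r: "r > 1" and less: "logplus (logplus x) / ln r < \<rho>"
  shows "x \<le> exp (r powr \<rho>)"
proof -
  have "ln r > 0" using r by simp
  then have le: "logplus (logplus x) < \<rho> * ln r" using less by (simp add: pos_divide_less_eq)
  have lp: "logplus x \<le> r powr \<rho>"
  proof (cases "logplus x > 0")
    case True
    have "ln (logplus x) \<le> \<rho> * ln r" using le by (auto simp: logplus_def)
    then have "exp (ln (logplus x)) \<le> exp (\<rho> * ln r)" by simp
    then show ?thesis using True r by (simp add: powr_def)
  next
    case False
    then show ?thesis by (smt (verit) powr_ge_zero)
  qed
  show ?thesis
  proof (cases "x > 0")
    case True
    have "ln x \<le> r powr \<rho>" using lp by (simp add: logplus_def)
    then have "exp (ln x) \<le> exp (r powr \<rho>)" by simp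
    then show ?thesis using True by simp
  next
    case False
    then show ?thesis using exp_gt_zero[of "r powr \<rho>"] by linarith
  qed
qed

lemma entire_order_growth:
  assumes hol: "f holomorphic_on UNIV" and ord: "entire_order f < ereal \<rho>"
  obtains S where "\<And>z. S \<le> Re z \<Longrightarrow> cmod (f (exp z)) \<le> exp (exp (\<rho> * Re z))"
proof -
  have "\<forall>\<^sub>F r in at_top. ereal (logplus (logplus (max_modulus f r)) / ln r) < ereal \<rho>"
    using ord unfolding entire_order_def by (rule Limsup_lessD)
  then obtain R where R: "\<And>r. r \<ge> R \<Longrightarrow> logplus (logplus (max_modulus f r)) / ln r < \<rho>"
    by (auto simp: eventually_at_top_linorder)
  show ?thesis
  proof (rule that[of "max 1 R"])
    fix z :: complex assume z: "max 1 R \<le> Re z"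
    define r where "r = exp (Re z)"
    have r: "r > 1" "r \<ge> R"
    proof -
      have "exp (Re z) \<ge> 1 + Re z" by (rule exp_ge_add_one_self)
      moreover have "1 \<le> Re z" "R \<le> Re z" using z by auto
      ultimately have "r > 1 \<and> r \<ge> R" unfolding r_def by linarith
      then show "r > 1" "r \<ge> R" by auto
    qed
    have "cmod (f (exp z)) \<le> max_modulus f r"
      using norm_le_max_modulus[OF hol, of "exp z"] by (simp add: r_def)
    also have "\<dots> \<le> exp (r powr \<rho>)" using le_exp_powr_of_logplus[OF r(1) R[OF r(2)]] .
    also have "r powr \<rho> = exp (\<rho> * Re z)" by (simp add: r_def powr_def)
    finally show "cmod (f (exp z)) \<le> exp (exp (\<rho> * Re z))" .
  qed
qed

text \<open>Periodicity reduces the whole vertical line to one compact period. The bound must hold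
  on the full line because the region later cut out of it varies with \<open>s1\<close>, whereas the
  initial bound on the flux may not.\<close>

lemma potential_periodic_bounded:
  assumes hol: "h holomorphic_on UNIV"
    and per: "\<And>z k. h (z + \<i> * (of_int k * (of_real pi * 2))) = h z"
  shows "\<exists>M. \<forall>t. \<bar>potential h (Complex s t) * potential_d1 h 1 (Complex s t)\<bar> \<le> M"
proof -
  define G where "G = (\<lambda>z. potential h z * potential_d1 h 1 z)"
  have perG: "G (z + \<i> * (of_int k * (of_real pi * 2))) = G z" for z k
  proof -
    have "deriv h (z + \<i> * (of_int k * (of_real pi * 2))) = deriv h z"
    proof -
      have "h \<circ> (+) (z + \<i> * (of_int k * (of_real pi * 2))) = h \<circ> (+) z"
        using per[of "z + w" k for w] by (auto simp: fun_eq_iff algebra_simps)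
      then show ?thesis by (metis deriv_shift_0)
    qed
    then show ?thesis by (simp add: G_def potential_def[OF hol] potential_d1_def[OF hol] normsq_def[OF hol] normsq_d1_def[OF hol] per)
  qed
  have "compact ((\<lambda>t. G (Complex s t)) ` {0..2 * pi})"
  proof (intro compact_continuous_image compact_Icc)
    have "continuous_on UNIV G" unfolding G_def by (intro continuous_intros continuous_potential hol)
    then show "continuous_on {0..2 * pi} (\<lambda>t. G (Complex s t))"
      by (rule continuous_on_compose2) (auto simp: Complex_eq intro!: continuous_intros)
  qed
  from compact_imp_bounded[OF this] obtain M where "\<forall>x\<in>(\<lambda>t. G (Complex s t)) ` {0..2 * pi}. norm x \<le> M"
    unfolding bounded_iff by blast
  then have M: "\<bar>G (Complex s t)\<bar> \<le> M" if "t \<in> {0..2 * pi}" for t using that by auto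
  have "\<bar>G (Complex s t)\<bar> \<le> M" for t
  proof -
    define k where "k = \<lfloor>t / (2 * pi)\<rfloor>"
    have k: "of_int k \<le> t / (2 * pi)" "t / (2 * pi) < of_int k + 1" unfolding k_def by linarith+
    define u where "u = t - 2 * pi * of_int k"
    have u: "u \<in> {0..2 * pi}" using k by (auto simp: u_def field_simps)
    have "Complex s t = Complex s u + \<i> * (of_int k * (of_real pi * 2))"
      by (simp add: complex_eq_iff u_def)
    then show ?thesis using M[OF u] perG by simp
  qed
  then show ?thesis by (auto simp: G_def)
qed

text \<open>The modulus of \<open>h\<close> is at most a constant times the square of
  \<open>exp X\<close>, so its logarithm is affine in \<open>X\<close>, and \<open>X \<ge> 1\<close>
  absorbs the constant term. Adding 1 inside the logarithm keeps that term nonnegative. In the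
  application \<open>X = exp (\<rho> * Re z)\<close>.\<close>

lemma potential_growth:
  fixes \<kappa> :: real
  assumes hol: "h holomorphic_on UNIV" and h: "h z = (w - a) * (w - b) / of_real \<kappa>"
    and w: "cmod w \<le> exp X" "X \<ge> 1" and A: "cmod a \<le> A" "cmod b \<le> A" and \<kappa>: "\<kappa> > 0"
  shows "potential h z \<le> (2 * ln ((1 + A)\<^sup>2 / \<kappa> + 1) + 4) * X"
proof -
  have A0: "A \<ge> 0" using A norm_ge_zero order_trans by blast
  have eX: "exp X \<ge> 1" using w by simp
  have le: "cmod (w - c) \<le> (1 + A) * exp X" if "cmod c \<le> A" for c
  proof -
    have "cmod (w - c) \<le> exp X + A" using norm_triangle_ineq4[of w c] w that by linarith
    also have "A \<le> A * exp X" using A0 eX mult_left_mono[of 1 "exp X" A] by simp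
    finally show ?thesis by (simp add: algebra_simps)
  qed
  define q where "q = (1 + A)\<^sup>2 / \<kappa>"
  have q0: "q \<ge> 0" using \<kappa> by (simp add: q_def)
  have "cmod (h z) = cmod (w - a) * cmod (w - b) / \<kappa>"
    using \<kappa> by (simp add: h norm_mult norm_divide)
  also have "\<dots> \<le> ((1 + A) * exp X) * ((1 + A) * exp X) / \<kappa>"
    using le A A0 \<kappa> by (intro divide_right_mono mult_mono) auto
  also have "\<dots> = q * (exp X)\<^sup>2" by (simp add: q_def power2_eq_square)
  also have "\<dots> \<le> (q + 1) * (exp X)\<^sup>2" by (intro mult_right_mono) auto
  finally have hG: "cmod (h z) \<le> (q + 1) * (exp X)\<^sup>2" .
  have G1: "1 \<le> (q + 1) * (exp X)\<^sup>2"
    using q0 eX mult_mono[of 1 "q + 1" 1 "(exp X)\<^sup>2"] by (simp add: one_le_power)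
  have "max 1 ((cmod (h z))\<^sup>2) \<le> ((q + 1) * (exp X)\<^sup>2)\<^sup>2"
    using power_mono[OF hG norm_ge_zero, of 2] one_le_power[OF G1, of 2] by simp
  then have "ln (max 1 ((cmod (h z))\<^sup>2)) \<le> ln (((q + 1) * (exp X)\<^sup>2)\<^sup>2)"
    by (intro ln_mono) auto
  also have "\<dots> = 2 * (ln (q + 1) + 2 * X)"
    using q0 by (simp add: ln_realpow ln_mult)
  also have "\<dots> \<le> (2 * ln (q + 1) + 4) * X"
  proof -
    have "ln (q + 1) * 1 \<le> ln (q + 1) * X" using q0 w by (intro mult_left_mono) auto
    then show ?thesis by (simp add: algebra_simps)
  qed
  finally show ?thesis
    using softlog_le_ln[of "(cmod (h z))\<^sup>2"] by (simp add: potential_def[OF hol] normsq_eq[OF hol] q_def)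
qed

text \<open>With \<open>d\<close> the distance of \<open>a\<close> and \<open>b\<close>, a point
  within \<open>d / 5\<close> of one value is within \<open>6 * d / 5\<close> of the other, whence
  the factor \<open>6 / 25\<close>. Equidistant points have product of distances at least
  \<open>d\<^sup>2 / 4\<close>, which is larger by the factor \<open>25 / 24\<close>.\<close>

lemma two_disc_quotient:
  fixes a b w :: complex and \<epsilon> :: real
  assumes \<epsilon>: "\<epsilon> < cmod (a - b) / 5"
  defines "q \<equiv> cmod (w - a) * cmod (w - b) / (6 / 25 * (cmod (a - b))\<^sup>2)"
  shows "cmod (w - a) < \<epsilon> \<Longrightarrow> q < 1" and "cmod (w - b) < \<epsilon> \<Longrightarrow> q < 1"
    and "cmod (w - a) = cmod (w - b) \<Longrightarrow> a \<noteq> b \<Longrightarrow> q \<ge> 25 / 24"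
proof -
  define d where "d = cmod (a - b)"
  have *: "x * y < 6 / 25 * d\<^sup>2" if "0 \<le> x" "0 \<le> y" "x < \<epsilon>" "y \<le> x + d" for x y
  proof -
    have "x < d / 5" "d > 0" using that \<epsilon> by (auto simp: d_def)
    moreover have "y < 6 / 5 * d" using that calculation by linarith
    ultimately have "x * y < d / 5 * (6 / 5 * d)"
      using that by (intro mult_strict_mono') auto
    then show ?thesis by (simp add: power2_eq_square)
  qed
  have tri: "cmod (w - b) \<le> cmod (w - a) + d" "cmod (w - a) \<le> cmod (w - b) + d" "d \<le> cmod (w - a) + cmod (w - b)"
    using norm_triangle_ineq[of "w - a" "a - b"] norm_triangle_ineq4[of "w - b" "a - b"]
      norm_triangle_ineq4[of "w - b" "w - a"] by (auto simp: d_def)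
  show "q < 1" if "cmod (w - a) < \<epsilon>"
    using *[of "cmod (w - a)" "cmod (w - b)"] tri that
    by (cases "d = 0") (auto simp: q_def simp flip: d_def)
  show "q < 1" if "cmod (w - b) < \<epsilon>"
    using *[of "cmod (w - b)" "cmod (w - a)"] tri that
    by (cases "d = 0") (auto simp: q_def d_def[symmetric] divide_less_eq mult.commute)
  show "q \<ge> 25 / 24" if "cmod (w - a) = cmod (w - b)" "a \<noteq> b"
  proof -
    have "d > 0" using that by (simp add: d_def)
    have "d / 2 \<le> cmod (w - a)" using tri that by simp
    then have "d / 2 * (d / 2) \<le> cmod (w - a) * cmod (w - a)"
      using \<open>d > 0\<close> by (intro mult_mono) auto
    then have "25 / 24 * (6 / 25 * d\<^sup>2) \<le> cmod (w - a) * cmod (w - b)"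
      using that(1) by (simp add: power2_eq_square)
    moreover have "6 / 25 * d\<^sup>2 > 0" using \<open>d > 0\<close> by simp
    ultimately show ?thesis unfolding q_def d_def[symmetric] by (simp only: pos_le_divide_eq)
  qed
qed

section \<open>Carleman's estimate for all regions together\<close>

text \<open>The barriers are rebuilt for every \<open>s\<close>, and with them the regions and
  possibly the order of the values, yet \<open>C\<close> and \<open>sb\<close> must not depend on
  \<open>s\<close>. Hence every constant is fixed in advance by summing over all pairs of indices
  instead of neighbouring ones.\<close>

lemma tract_product_bound:
  fixes f :: "complex \<Rightarrow> complex" and a :: "nat \<Rightarrow> complex" and \<gamma> :: "nat \<Rightarrow> real \<Rightarrow> complex"
  assumes hol: "f holomorphic_on UNIV" and n: "n \<ge> 2"
    and sep: "\<And>i j. i < n \<Longrightarrow> j < n \<Longrightarrow> i \<noteq> j \<Longrightarrow> \<epsilon> < cmod (a i - a j) / 5"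
    and inj: "inj_on a {..<n}"
    and cont: "\<And>i. i < n \<Longrightarrow> continuous_on {T i..} (\<gamma> i)"
    and lim: "\<And>i. i < n \<Longrightarrow> filterlim (\<gamma> i) at_infinity at_top"
    and start: "\<And>i. i < n \<Longrightarrow> norm (\<gamma> i (T i)) < exp s0"
    and near: "\<And>i t. i < n \<Longrightarrow> T i \<le> t \<Longrightarrow> cmod (f (\<gamma> i t) - a i) < \<epsilon>"
    and \<rho>: "\<rho> \<ge> 0" and s0: "s0 \<ge> 0"
    and growth: "\<And>z. s0 \<le> Re z \<Longrightarrow> cmod (f (exp z)) \<le> exp (exp (\<rho> * Re z))"
  obtains C sb where "C \<ge> 1"
    "\<And>s. sb \<le> s \<Longrightarrow> exp (real n ^ 2 * (s - sb)) \<le> ((C * exp (\<rho> * (s + 1)))\<^sup>2 * pi) ^ n"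
proof -
  define \<kappa> where "\<kappa> = (\<lambda>i k. 6 / 25 * (cmod (a i - a k))\<^sup>2)"
  define H where "H = (\<lambda>i k z. (f (exp z) - a i) * (f (exp z) - a k) / of_real (\<kappa> i k))"
  have holH: "H i k holomorphic_on UNIV" for i k
  proof -
    have "(\<lambda>z. f (exp z)) holomorphic_on UNIV"
      using holomorphic_on_compose_gen[OF holomorphic_on_exp hol] by (auto simp: o_def)
    then show ?thesis unfolding H_def divide_inverse by (intro holomorphic_intros)
  qed
  have perH: "H i k (z + \<i> * (of_int l * (of_real pi * 2))) = H i k z" for i k z l
    by (simp only: H_def exp_plus_2pin)
  have normH: "cmod (H i k z) = cmod (f (exp z) - a i) * cmod (f (exp z) - a k) / (6 / 25 * (cmod (a i - a k))\<^sup>2)" for i k z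
    by (simp add: H_def \<kappa>_def norm_mult norm_divide norm_power)
  have "\<exists>M. \<forall>t. \<bar>potential (H i k) (Complex (s0 + 1) t) * potential_d1 (H i k) 1 (Complex (s0 + 1) t)\<bar> \<le> M" for i k
    using potential_periodic_bounded[OF holH perH] .
  then obtain M0 where M0: "\<And>i k t. \<bar>potential (H i k) (Complex (s0 + 1) t) * potential_d1 (H i k) 1 (Complex (s0 + 1) t)\<bar> \<le> M0 i k"
    by metis
  have dsum: "g i k \<le> (\<Sum>i<n. \<Sum>k<n. \<bar>g i k\<bar>)" if "i < n" "k < n" for g :: "nat \<Rightarrow> nat \<Rightarrow> real" and i k
  proof -
    have "g i k \<le> \<bar>g i k\<bar>" by simp
    also have "\<dots> \<le> (\<Sum>k<n. \<bar>g i k\<bar>)" using that by (intro member_le_sum[of k]) auto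
    also have "\<dots> \<le> (\<Sum>i<n. \<Sum>k<n. \<bar>g i k\<bar>)"
      using that by (intro member_le_sum[of i "{..<n}" "\<lambda>i. \<Sum>k<n. \<bar>g i k\<bar>"]) (auto intro!: sum_nonneg)
    finally show ?thesis .
  qed
  define M where "M = (\<Sum>i<n. \<Sum>k<n. \<bar>M0 i k\<bar>)"
  have M: "\<bar>potential (H i k) (Complex (s0 + 1) t) * potential_d1 (H i k) 1 (Complex (s0 + 1) t)\<bar> \<le> M" if "i < n" "k < n" for i k t
    using M0[of i k t] dsum[OF that, of M0] by (simp add: M_def)
  have Mnn: "M \<ge> 0" unfolding M_def by (intro sum_nonneg) auto
  define A where "A = (\<Sum>i<n. cmod (a i))"
  have A: "cmod (a i) \<le> A" if "i < n" for i
    unfolding A_def using that by (intro member_le_sum) auto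
  define C0 where "C0 = (\<lambda>i k. 2 * ln ((1 + A)\<^sup>2 / \<kappa> i k + 1) + 4)"
  define C where "C = 1 + (\<Sum>i<n. \<Sum>k<n. \<bar>C0 i k\<bar>)"
  have C1: "C \<ge> 1" unfolding C_def by (simp add: sum_nonneg)
  have upper: "potential (H i k) z \<le> C * exp (\<rho> * Re z)" if "i < n" "k < n" "i \<noteq> k" "s0 \<le> Re z" for i k z
  proof -
    have "a i \<noteq> a k" using inj that by (auto simp: inj_on_def)
    then have "\<kappa> i k > 0" by (simp add: \<kappa>_def)
    moreover have "exp (\<rho> * Re z) \<ge> 1" using \<rho> s0 that by simp
    ultimately have "potential (H i k) z \<le> C0 i k * exp (\<rho> * Re z)"
      unfolding C0_def using growth[OF that(4)] A that
      by (intro potential_growth[OF holH, of _ _ _ "f (exp z)" "a i" "a k"]) (auto simp: H_def)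
    also have "\<dots> \<le> C * exp (\<rho> * Re z)"
      using dsum[OF that(1,2), of C0] by (intro mult_right_mono) (auto simp: C_def)
    finally show ?thesis .
  qed
  \<comment> \<open>The potential at modulus \<open>25 / 24\<close>, a lower bound at the
    equidistant point of each section. A section has length at most \<open>2 * pi\<close>, so the
    oscillation bound yields the rate \<open>c\<close>.\<close>
  define c0 where "c0 = softlog ((25 / 24)\<^sup>2)"
  have c0: "c0 > 0" unfolding c0_def by (intro softlog_pos) (simp add: power2_eq_square)
  define c where "c = c0\<^sup>2 / (2 * pi)"
  have c: "c > 0" using c0 by (simp add: c_def)
  \<comment> \<open>The flux is at least \<open>- M * (2 * pi)\<close> on the column
    \<open>s0 + 1\<close>; growth at rate \<open>c\<close> makes it at least 1 from
    \<open>sb\<close> on. The column is \<open>s0 + 1\<close> because the strip is open at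
    \<open>s0\<close>.\<close>
  define sb where "sb = s0 + 1 + (M * (2 * pi) + 1) / c"
  have sb: "s0 + 1 < sb" using Mnn c by (simp add: sb_def add_nonneg_pos)
  define V where "V = (\<lambda>i. {w. cmod (f w - a i) < \<epsilon>})"
  have disjV: "V i \<inter> V j = {}" if "i < n" "j < n" "i \<noteq> j" for i j
  proof -
    have "cmod (a i - a j) \<le> cmod (f w - a i) + cmod (f w - a j)" for w
      using norm_triangle_ineq4[of "f w - a j" "f w - a i"] by simp
    moreover have "cmod (a i - a j) > 2 * \<epsilon>" using sep[OF that] norm_ge_zero[of "a i - a j"] by linarith
    ultimately have "\<not> (cmod (f w - a i) < \<epsilon> \<and> cmod (f w - a j) < \<epsilon>)" for w
      by (smt (verit))
    then show ?thesis unfolding V_def by blast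
  qed
  have "exp (real n ^ 2 * (s - sb)) \<le> ((C * exp (\<rho> * (s + 1)))\<^sup>2 * pi) ^ n" if s: "sb \<le> s" for s
  proof -
    \<comment> \<open>Leaves \<open>s + 1\<close>, where the mean squares are evaluated, strictly
      inside the strip.\<close>
    define s1 where "s1 = s + 2"
    have s01: "s0 < s1" using sb s by (simp add: s1_def)
    obtain K y \<sigma> where cr: "\<And>m. crossing s0 s1 (y m) (K m)" and ysm: "strict_mono y"
      and \<sigma>: "\<And>m. \<sigma> m < n" "\<And>m. \<sigma> m \<noteq> \<sigma> (Suc m)"
      and KV: "\<And>m z. z \<in> K m \<Longrightarrow> s0 \<le> Re z \<Longrightarrow> exp z \<in> V (\<sigma> m)"
      and dj: "\<And>m. K m \<inter> K (Suc m) = {}"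
      and per: "\<And>m. K (m + n) = (+) (Complex 0 (2 * pi)) ` K m"
    proof (rule crossing_family[OF n s01 cont lim start _ disjV])
      show "\<gamma> i ` {T i..} \<subseteq> V i" if "i < n" for i using near[OF that] by (auto simp: V_def)
    qed blast+
    define D where "D = (\<lambda>m. side 1 s0 s1 (K m) \<inter> side (-1) s0 s1 (K (Suc m)))"
    define h where "h = (\<lambda>m. H (\<sigma> m) (\<sigma> (Suc m)))"
    define l where "l = (\<lambda>m t. measure lebesgue {u. Complex t u \<in> D m})"
    have holh: "h m holomorphic_on UNIV" for m unfolding h_def by (rule holH)
    have suml: "(\<Sum>j<n. l j t) \<le> 2 * pi" for t
      unfolding l_def D_def by (rule region_sections[OF s01 cr ysm dj per])
    have l_nn: "l j t \<ge> 0" for j t by (simp add: l_def)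
    have l_le: "l j t \<le> 2 * pi" if "j < n" for j t
      using member_le_sum[of j "{..<n}" "\<lambda>j. l j t"] that l_nn suml[of t] by auto
    have "\<exists>L. \<forall>z\<in>D m. \<bar>Im z\<bar> \<le> L" for m
      unfolding D_def using region_bounded[OF cr cr s01, of m "Suc m"] by metis
    then obtain L0 where L0: "\<And>m z. z \<in> D m \<Longrightarrow> \<bar>Im z\<bar> \<le> L0 m" by metis
    define L where "L = (\<lambda>m. max 0 (L0 m))"
    have L: "\<bar>Im z\<bar> \<le> L m" if "z \<in> D m" for z m using L0[OF that] by (simp add: L_def)
    have cl: "closed (K m)" for m using cr by (simp add: crossing_def)
    have openD: "open (D m)" for m unfolding D_def by (intro open_Int side_open cl)
    have hK: "cmod (h m z) < 1" if "z \<in> K m \<or> z \<in> K (Suc m)" "s0 \<le> Re z" for m z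
    proof -
      have "exp z \<in> V (\<sigma> m) \<or> exp z \<in> V (\<sigma> (Suc m))" using that KV by blast
      then show ?thesis
        unfolding h_def normH V_def using two_disc_quotient(1,2)[OF sep[OF \<sigma>(1) \<sigma>(1) \<sigma>(2)], of "f (exp z)" m] by blast
    qed
    define v where "v = (\<lambda>m. cutoff (D m) (potential (h m)))"
    define vs where "vs = (\<lambda>m. cutoff (D m) (potential_d1 (h m) 1))"
    have strip: "subharmonic_strip (v m) (vs m) (cutoff (D m) (potential_d2 (h m) 1)) (cutoff (D m) (potential_d1 (h m) \<i>))
        (cutoff (D m) (potential_d2 (h m) \<i>)) s0 s1 (- L m) (L m) (\<lambda>t. {u. Complex t u \<in> D m})" for m
      unfolding v_def vs_def
    proof (rule subharmonic_strip_cutoff[OF holh openD])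
      show "L m \<ge> 0" by (simp add: L_def)
      fix z assume z: "s0 < Re z" "Re z < s1" "z \<in> closure (D m)" "z \<notin> D m"
      have "z \<in> closure (side 1 s0 s1 (K m))" "z \<in> closure (side (-1) s0 s1 (K (Suc m)))"
        using z(3) closure_mono[of "D m"] by (auto simp: D_def)
      then have "z \<in> K m \<or> z \<in> K (Suc m)"
        using side_frontier[OF cl _ z(2)] z(4) unfolding D_def by blast
      then show "cmod (h m z) < 1" using hK z by auto
    qed (rule L)
    define B where "B = (\<lambda>m. subharmonic_strip.flux (v m) (vs m) (- L m) (L m))"
    define B' where "B' = (\<lambda>m. subharmonic_strip.flux' (v m) (vs m) (cutoff (D m) (potential_d2 (h m) 1)) (- L m) (L m))"
    define mm where "mm = (\<lambda>m. subharmonic_strip.sq_mean (v m) (- L m) (L m))"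
    \<comment> \<open>Each section contains an interval with one end on \<open>K m\<close> and the
      other on \<open>K (Suc m)\<close>. Along it the potential rises from 0 at the first end to at
      least \<open>c0\<close> at a point equidistant from the two values.\<close>
    have col: "B' m t \<ge> c \<and> l m t > 0" if m: "m < n" and t: "s0 < t" "t < s1" for m t
    proof -
      obtain x q where xq: "x < q" "Complex t x \<in> K m" "Complex t q \<in> K (Suc m)"
        and sub: "\<And>u. x < u \<Longrightarrow> u < q \<Longrightarrow> Complex t u \<in> D m"
        unfolding D_def
        using region_column[OF cr cr strict_monoD[OF ysm lessI] _ t, of m] dj[of m] by (metis Int_empty_left)
      have mem: "Complex t u \<in> D m \<Longrightarrow> \<bar>u\<bar> \<le> L m" for u using L by force
      have bx: "- L m \<le> x"
      proof (rule ccontr)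
        assume "\<not> - L m \<le> x"
        then obtain u where "x < u" "u < min q (- L m)" using dense[of x "min q (- L m)"] xq by auto
        then show False using mem[OF sub[of u]] by auto
      qed
      have bdd: "bounded {u. Complex t u \<in> D m}"
        using mem by (intro boundedI[of _ "L m"]) auto
      have op: "open {u. Complex t u \<in> D m}"
        using subharmonic_strip.T(1)[OF strip t] .
      have "measure lebesgue {x<..<q} \<le> l m t"
        unfolding l_def using sub op bdd
        by (intro measure_mono_fmeasurable bounded_set_imp_lmeasurable) auto
      then have ql: "q - x \<le> l m t" using xq by simp
      define d where "d = (\<lambda>i u. cmod (f (exp (Complex t u)) - a i))"
      let ?i = "\<sigma> m" and ?k = "\<sigma> (Suc m)"
      have contd: "continuous_on S (d i)" for i S
        unfolding d_def using holomorphic_on_imp_continuous_on[OF hol]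
        by (intro continuous_intros continuous_on_compose2[OF holomorphic_on_imp_continuous_on[OF hol]])
          (auto simp: Complex_eq intro!: continuous_intros)
      have dx: "d ?i x < \<epsilon>" "d ?k q < \<epsilon>"
        using KV[OF xq(2)] KV[OF xq(3)] t by (auto simp: V_def d_def)
      have dlow: "d i u > \<epsilon>" if "d j u < \<epsilon>" "i < n" "j < n" "i \<noteq> j" for i j u
      proof -
        have "exp (Complex t u) \<notin> V i" using disjV[OF that(2-4)] that(1) by (auto simp: V_def d_def)
        moreover have "cmod (a i - a j) \<le> d i u + d j u"
          unfolding d_def using norm_triangle_ineq4[of "f (exp (Complex t u)) - a j" "f (exp (Complex t u)) - a i"] by simp
        moreover have "cmod (a i - a j) > 2 * \<epsilon>"
          using sep[OF that(2-4)] norm_ge_zero[of "a i - a j"] by linarith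
        ultimately show ?thesis using that(1) by linarith
      qed
      \<comment> \<open>The difference of the distances to the two values changes sign, because each
        end is closer than \<open>\<epsilon>\<close> to its own value and farther than
        \<open>\<epsilon>\<close> from the other.\<close>
      have "\<exists>u\<ge>x. u \<le> q \<and> d ?i u - d ?k u = 0"
      proof (rule IVT')
        show "d ?i x - d ?k x \<le> 0" using dx(1) dlow[OF dx(1) \<sigma>(1) \<sigma>(1) \<sigma>(2)[symmetric]] by linarith
        show "0 \<le> d ?i q - d ?k q" using dx(2) dlow[OF dx(2) \<sigma>(1) \<sigma>(1) \<sigma>(2)] by linarith
      qed (use xq in \<open>auto intro!: continuous_intros contd\<close>)
      then obtain u where u: "x \<le> u" "u \<le> q" "d ?i u = d ?k u" by auto
      have ux: "x < u" "u < q"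
        using u dx dlow[OF dx(1) \<sigma>(1) \<sigma>(1) \<sigma>(2)[symmetric]] dlow[OF dx(2) \<sigma>(1) \<sigma>(1) \<sigma>(2)]
        by (cases "u = x"; cases "u = q"; force)+
      have uD: "Complex t u \<in> D m" using sub ux by blast
      have "a ?i \<noteq> a ?k" using inj \<sigma>(1)[of m] \<sigma>(1)[of "Suc m"] \<sigma>(2)[of m] by (auto simp: inj_on_def)
      then have "cmod (h m (Complex t u)) \<ge> 25 / 24"
        unfolding h_def normH using two_disc_quotient(3)[OF sep[OF \<sigma>(1) \<sigma>(1) \<sigma>(2)], of "f (exp (Complex t u))" m] u(3)
        by (simp add: d_def)
      then have "(25 / 24)\<^sup>2 \<le> (cmod (h m (Complex t u)))\<^sup>2" by (intro power_mono) auto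
      then have vu: "v m t u \<ge> c0"
        using uD softlog_mono by (simp add: v_def cutoff_def c0_def potential_def[OF holh] normsq_eq[OF holh])
      have vx: "v m t x = 0"
        using sideD[of "Complex t x" 1 s0 s1 "K m"] xq by (auto simp: v_def cutoff_def D_def)
      have "B' m t \<ge> c0\<^sup>2 / (2 * pi)"
        unfolding B'_def
      proof (rule subharmonic_strip.flux'_ge_oscillation[OF strip t vx vu bx])
        show "u \<le> L m" using mem[OF uD] by simp
        show "u - x \<le> 2 * pi" using ql l_le[OF m, of t] ux by linarith
      qed (use u c0 in auto)
      then show ?thesis using ql xq by (auto simp: c_def)
    qed
    have t0: "s0 < s0 + 1" "s0 + 1 < s1" using sb s by (auto simp: s1_def)
    have "exp (real n ^ 2 * (s - sb)) \<le> (\<Prod>j<n. mm j (s + 1) / 2)"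
    proof (rule product_growth[where B = B and B' = B' and l = l and c = c and sa = "s0 + 1" and ?s1.0 = s1 and ?K0.0 = "M * (2 * pi)"])
      fix j t assume j: "j < n" and t: "s0 < t" "t < s1"
      show "(mm j has_real_derivative 2 * B j t) (at t)"
        unfolding mm_def B_def by (rule subharmonic_strip.sq_mean_deriv[OF strip t])
      show "(B j has_real_derivative B' j t) (at t)"
        unfolding B_def B'_def by (rule subharmonic_strip.flux_deriv[OF strip t])
      show "c \<le> B' j t" "0 < l j t" using col[OF j t] by auto
      then show "2 * (pi / l j t) * B j t \<le> B' j t"
        unfolding l_def B_def B'_def by (intro subharmonic_strip.flux'_ge_length[OF strip t])
      show "0 \<le> mm j t" unfolding mm_def by (rule subharmonic_strip.sq_mean_nonneg[OF strip t])
    next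
      fix j assume j: "j < n"
      have "\<bar>v j (s0 + 1) t * vs j (s0 + 1) t\<bar> \<le> M" for t
        using M[OF \<sigma>(1) \<sigma>(1), of j "Suc j" t] Mnn by (auto simp: v_def vs_def cutoff_def h_def)
      then show "- (M * (2 * pi)) \<le> B j (s0 + 1)"
        unfolding B_def using l_le[OF j, of "s0 + 1"] unfolding l_def
        by (intro subharmonic_strip.flux_ge[OF strip t0])
    qed (use c suml Mnn s in \<open>auto simp: sb_def s1_def\<close>)
    also have "\<dots> \<le> (\<Prod>j<n. (C * exp (\<rho> * (s + 1)))\<^sup>2 * pi)"
    proof (rule prod_mono)
      fix j assume "j \<in> {..<n}"
      then have j: "j < n" by simp
      have t: "s0 < s + 1" "s + 1 < s1" using sb s by (auto simp: s1_def)
      have "v j (s + 1) u \<le> C * exp (\<rho> * (s + 1))" for u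
        using upper[OF \<sigma>(1) \<sigma>(1) \<sigma>(2), of "Complex (s + 1) u" j] t C1
        by (auto simp: v_def cutoff_def h_def)
      then have "mm j (s + 1) \<le> (C * exp (\<rho> * (s + 1)))\<^sup>2 * (2 * pi)"
        unfolding mm_def using l_le[OF j, of "s + 1"] unfolding l_def
        by (intro subharmonic_strip.sq_mean_le[OF strip t])
      moreover have "mm j (s + 1) \<ge> 0" unfolding mm_def by (rule subharmonic_strip.sq_mean_nonneg[OF strip t])
      ultimately show "0 \<le> mm j (s + 1) / 2 \<and> mm j (s + 1) / 2 \<le> (C * exp (\<rho> * (s + 1)))\<^sup>2 * pi"
        by simp
    qed
    finally show ?thesis by simp
  qed
  then show ?thesis using that C1 by blast
qed

section \<open>Contradiction between the two growth rates\<close>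

theorem theorem6p1:
  fixes f :: "complex \<Rightarrow> complex" and a :: "nat \<Rightarrow> complex"
    and n :: nat and \<epsilon> :: real
  assumes "f holomorphic_on UNIV"
    and "entire_order f < \<infinity>"
    and "n \<ge> 2"
    and "inj_on a {..<n}"
    and "\<And>i. i < n \<Longrightarrow> approx_asymptotic_value \<epsilon> f (a i)"
    and "\<And>i j. i < n \<Longrightarrow> j < n \<Longrightarrow> i \<noteq> j \<Longrightarrow> \<epsilon> < cmod (a i - a j) / 5"
  shows "entire_order f \<ge> ereal (real n / 2)"
proof (rule ccontr)
  assume "\<not> ?thesis"
  then have "entire_order f < ereal (real n / 2)" by simp
  then obtain \<rho>' where \<rho>': "entire_order f < ereal \<rho>'" "ereal \<rho>' < ereal (real n / 2)"
    using ereal_dense2 by blast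
  \<comment> \<open>A nonnegative exponent ensures \<open>exp (\<rho> * Re z) \<ge> 1\<close> for
    \<open>Re z \<ge> 0\<close>, as the potential bound requires, and it is still below
    \<open>n / 2\<close>.\<close>
  define \<rho> where "\<rho> = max \<rho>' 0"
  have "ereal \<rho>' \<le> ereal \<rho>" by (simp add: \<rho>_def)
  with \<rho>'(1) have "entire_order f < ereal \<rho>" by (rule less_le_trans)
  moreover have "\<rho> \<ge> 0" "\<rho> < real n / 2" using \<rho>'(2) assms(3) by (auto simp: \<rho>_def)
  ultimately have \<rho>: "entire_order f < ereal \<rho>" "\<rho> \<ge> 0" "\<rho> < real n / 2" by auto
  obtain S where S: "\<And>z. S \<le> Re z \<Longrightarrow> cmod (f (exp z)) \<le> exp (exp (\<rho> * Re z))"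
    using entire_order_growth[OF assms(1) \<rho>(1)] by blast
  have "\<exists>(\<gamma> :: real \<Rightarrow> complex) T. continuous_on {T..} \<gamma> \<and> filterlim \<gamma> at_infinity at_top \<and> (\<forall>t\<ge>T. cmod (f (\<gamma> t) - a i) < \<epsilon>)"
    if "i < n" for i
  proof -
    obtain \<gamma> :: "real \<Rightarrow> complex" where \<gamma>: "continuous_on {0..} \<gamma>" "filterlim \<gamma> at_infinity at_top"
      "Limsup at_top (\<lambda>t. ereal (cmod (f (\<gamma> t) - a i))) < ereal \<epsilon>"
      using assms(5)[OF \<open>i < n\<close>] unfolding approx_asymptotic_value_def by blast
    from Limsup_lessD[OF \<gamma>(3)] obtain T where T: "\<And>t. t \<ge> T \<Longrightarrow> cmod (f (\<gamma> t) - a i) < \<epsilon>"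
      by (auto simp: eventually_at_top_linorder)
    have "continuous_on {max 0 T..} \<gamma>" using \<gamma>(1) by (rule continuous_on_subset) auto
    then show ?thesis using \<gamma>(2) T by (intro exI[of _ \<gamma>] exI[of _ "max 0 T"]) auto
  qed
  then obtain \<gamma> :: "nat \<Rightarrow> real \<Rightarrow> complex" and T :: "nat \<Rightarrow> real" where \<gamma>: "\<And>i. i < n \<Longrightarrow> continuous_on {T i..} (\<gamma> i)"
      "\<And>i. i < n \<Longrightarrow> filterlim (\<gamma> i) at_infinity at_top"
      "\<And>i t. i < n \<Longrightarrow> T i \<le> t \<Longrightarrow> cmod (f (\<gamma> i t) - a i) < \<epsilon>"
    by metis
  define N where "N = (\<Sum>i<n. cmod (\<gamma> i (T i)))"
  \<comment> \<open>Beyond the growth threshold \<open>S\<close>, and so large that all starting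
    points lie inside the circle of radius \<open>exp s0\<close>, since
    \<open>N \<le> s0 < exp s0\<close>.\<close>
  define s0 where "s0 = max (max 0 S) N"
  have start: "cmod (\<gamma> i (T i)) < exp s0" if "i < n" for i
  proof -
    have "cmod (\<gamma> i (T i)) \<le> N" unfolding N_def using that by (intro member_le_sum) auto
    also have "N \<le> s0" by (simp add: s0_def)
    also have "s0 < exp s0" using exp_ge_add_one_self[of s0] by linarith
    finally show ?thesis .
  qed
  obtain C sb where C: "C \<ge> 1"
    and bound: "\<And>s. sb \<le> s \<Longrightarrow> exp (real n ^ 2 * (s - sb)) \<le> ((C * exp (\<rho> * (s + 1)))\<^sup>2 * pi) ^ n"
    by (rule tract_product_bound[OF assms(1,3,6,4) \<gamma>(1,2) start \<gamma>(3) \<rho>(2)])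
      (use S in \<open>auto simp: s0_def\<close>)
  have n0: "real n > 0" using assms(3) by simp
  \<comment> \<open>Logarithms of the product bound, divided by \<open>n\<close>. The slope
    \<open>n - 2 * \<rho>\<close> is positive, so the left side is unbounded in
    \<open>s\<close>.\<close>
  have lin: "(real n - 2 * \<rho>) * s \<le> real n * sb + 2 * ln C + 2 * \<rho> + ln pi" if s: "sb \<le> s" for s
  proof -
    have "ln (exp (real n ^ 2 * (s - sb))) \<le> ln (((C * exp (\<rho> * (s + 1)))\<^sup>2 * pi) ^ n)"
      using bound[OF s] by (intro ln_mono) auto
    also have "\<dots> = real n * (2 * (ln C + \<rho> * (s + 1)) + ln pi)"
      using C by (simp add: ln_realpow ln_mult)
    finally have "real n * (real n * (s - sb)) \<le> real n * (2 * (ln C + \<rho> * (s + 1)) + ln pi)"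
      by (simp add: power2_eq_square mult.assoc)
    then have "real n * (s - sb) \<le> 2 * (ln C + \<rho> * (s + 1)) + ln pi" using n0 by simp
    then show ?thesis by (simp add: algebra_simps)
  qed
  define R where "R = \<bar>real n * sb + 2 * ln C + 2 * \<rho> + ln pi\<bar> + 1"
  have d: "real n - 2 * \<rho> > 0" using \<rho>(3) by simp
  have "R \<le> (real n - 2 * \<rho>) * max sb (R / (real n - 2 * \<rho>))"
  proof -
    have "(real n - 2 * \<rho>) * (R / (real n - 2 * \<rho>)) \<le> (real n - 2 * \<rho>) * max sb (R / (real n - 2 * \<rho>))"
      using d by (intro mult_left_mono) auto
    then show ?thesis using d by simp
  qed
  also have "\<dots> \<le> real n * sb + 2 * ln C + 2 * \<rho> + ln pi" by (rule lin) simp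
  finally show False by (simp add: R_def)
qed

end
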